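(* Let $L$ be a valid skip list (as defined in the context) and let $B=\{(x_1,y_1),\dots,(x_k,y_k)\}$ be a set of valid join inputs: each $x_i$ is (the bottom-level node of) the last element of some sequence stored in $L$, each $y_i$ is (the bottom-level node of) the first element of some sequence stored in $L$, and for distinct tuples $(x_i,y_i)\neq(x_j,y_j)$ we have $x_i\neq x_j$ and $y_i\neq y_j$. Suppose $\textsc{Join}(x_i,y_i)$ is invoked concurrently for all $i=1,\dots,k$, with all memory instructions (reads, writes, compare-and-swaps) linearizable and no other operations running. Then every call terminates, and the resulting skip list is the same as the one obtained by performing the joins $\textsc{Join}(x_1,y_1),\dots,\textsc{Join}(x_k,y_k)$ one after another sequentially, i.e., the resulting structure is the valid skip list representing the concatenated sequences.
   Context: A skip list stores a collection of sequences (each possibly cyclic, i.e. its tail may be linked back to its head). Each element $x$ has a height $h\ge 1$ and one node $v_1,\dots,v_h$ per level; each node has four pointers left, right, up, down, with $v_i\to\mathrm{up}=v_{i+1}$, $v_i\to\mathrm{down}=v_{i-1}$ (null where undefined). In a valid skip list, at each level $i$ the nodes of elements of height at least $i$ form a doubly linked list in sequence order: $v_i\to\mathrm{right}$ is the level-$i$ node of the next element of its sequence having height $\ge i$, and $v_i\to\mathrm{left}$ is the level-$i$ node of the previous such element (null if none). Joining two sequences concatenates them; the join of $x$ (last element of one sequence) with $y$ (first element of another) produces the valid skip list of the concatenation (joining a sequence's last element to its own first element makes it cyclic). $\textsc{SearchLeft}(v)$: set $c=v$; while $c\to\mathrm{up}$ is null: set $c=c\to\mathrm{left}$, and if $c$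 is null or $c=v$ return null; finally return $c\to\mathrm{up}$. $\textsc{SearchRight}$ is symmetric (using right pointers). $\textsc{Join}(v_L,v_R)$: if $\mathrm{CAS}(\&v_L\to\mathrm{right},\mathrm{null},v_R)$ succeeds, then set $v_R\to\mathrm{left}=v_L$; let $p_L=\textsc{SearchLeft}(v_L)$ and $p_R=\textsc{SearchRight}(v_R)$; if both are non-null, recursively call $\textsc{Join}(p_L,p_R)$. Here $\mathrm{CAS}(\&x,o,n)$ atomically sets the location $x$ to $n$ if it currently holds $o$ and returns true, otherwise returns false. *)

theory Defs
  imports Main
begin

record 'p heap =
  ptr_left :: "'p \<Rightarrow> 'p option"
  ptr_right :: "'p \<Rightarrow> 'p option"
  ptr_up :: "'p \<Rightarrow> 'p option"
  ptr_down :: "'p \<Rightarrow> 'p option"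

datatype 'e sequence = Linear (elems: "'e list") | Cyclic (elems: "'e list")

fun next_elem :: "'e sequence \<Rightarrow> nat \<Rightarrow> 'e option" where
  "next_elem (Linear xs) j = (if Suc j < length xs then Some (xs ! Suc j) else None)"
| "next_elem (Cyclic xs) j = Some (xs ! (Suc j mod length xs))"

fun prev_elem :: "'e sequence \<Rightarrow> nat \<Rightarrow> 'e option" where
  "prev_elem (Linear xs) j = (if 0 < j then Some (xs ! (j - 1)) else None)"
| "prev_elem (Cyclic xs) j = Some (xs ! ((j + length xs - 1) mod length xs))"

fun at_level :: "('e \<Rightarrow> nat) \<Rightarrow> nat \<Rightarrow> 'e sequence \<Rightarrow> 'e sequence" where
  "at_level h i (Linear xs) = Linear (filter (\<lambda>e. i \<le> h e) xs)"
| "at_level h i (Cyclic xs) = Cyclic (filter (\<lambda>e. i \<le> h e) xs)"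

definition well_formed :: "'e sequence set \<Rightarrow> bool" where
  "well_formed S \<longleftrightarrow> finite S \<and>
     (\<forall>s\<in>S. elems s \<noteq> [] \<and> distinct (elems s)) \<and>
     (\<forall>s\<in>S. \<forall>t\<in>S. s \<noteq> t \<longrightarrow> set (elems s) \<inter> set (elems t) = {})"

text \<open>The level-\<open>i\<close> node of an element \<open>e\<close> is the address \<open>(e, i)\<close>, for \<open>1 \<le> i \<le> h e\<close>. All other
  addresses are unallocated, and validity says nothing about their contents.\<close>

definition linked_at :: "('e \<times> nat) heap \<Rightarrow> nat \<Rightarrow> 'e sequence \<Rightarrow> bool" where
  "linked_at m i s \<longleftrightarrow> (\<forall>j < length (elems s).
     ptr_right m (elems s ! j, i) = map_option (\<lambda>e. (e, i)) (next_elem s j) \<and>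
     ptr_left m (elems s ! j, i) = map_option (\<lambda>e. (e, i)) (prev_elem s j))"

definition valid_skip_list ::
  "('e \<Rightarrow> nat) \<Rightarrow> 'e sequence set \<Rightarrow> ('e \<times> nat) heap \<Rightarrow> bool" where
  "valid_skip_list h S m \<longleftrightarrow> well_formed S \<and>
     (\<forall>s\<in>S. \<forall>e\<in>set (elems s). 1 \<le> h e \<and>
        (\<forall>i\<in>{1..h e}.
           ptr_up m (e, i) = (if i < h e then Some (e, i + 1) else None) \<and>
           ptr_down m (e, i) = (if 1 < i then Some (e, i - 1) else None))) \<and>
     (\<forall>s\<in>S. \<forall>i\<ge>1. linked_at m i (at_level h i s))"

text \<open>Only non-cyclic sequences have a first and a last element.\<close>

definition valid_join_inputs :: "'e sequence set \<Rightarrow> ('e \<times> 'e) list \<Rightarrow> bool" where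
  "valid_join_inputs S B \<longleftrightarrow> distinct B \<and>
     (\<forall>(x, y)\<in>set B. (\<exists>xs. Linear xs \<in> S \<and> last xs = x) \<and> (\<exists>ys. Linear ys \<in> S \<and> hd ys = y)) \<and>
     (\<forall>(x, y)\<in>set B. \<forall>(x', y')\<in>set B. (x, y) \<noteq> (x', y') \<longrightarrow> x \<noteq> x' \<and> y \<noteq> y')"

inductive join_sequences ::
  "'e sequence set \<Rightarrow> 'e \<times> 'e \<Rightarrow> 'e sequence set \<Rightarrow> bool" where
  concat: "\<lbrakk>Linear xs \<in> S; Linear ys \<in> S; xs \<noteq> ys; last xs = x; hd ys = y\<rbrakk> \<Longrightarrow>
    join_sequences S (x, y) (insert (Linear (xs @ ys)) (S - {Linear xs, Linear ys}))"
| close: "\<lbrakk>Linear xs \<in> S; last xs = x; hd xs = y\<rbrakk> \<Longrightarrow>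
    join_sequences S (x, y) (insert (Cyclic xs) (S - {Linear xs}))"

inductive join_all :: "'e sequence set \<Rightarrow> ('e \<times> 'e) list \<Rightarrow> 'e sequence set \<Rightarrow> bool" where
  Nil: "join_all S [] S"
| Cons: "\<lbrakk>join_sequences S b S'; join_all S' B S''\<rbrakk> \<Longrightarrow> join_all S (b # B) S''"

text \<open>Each control state of a call of Join, other than \<open>Done\<close>, is about to execute exactly one memory
  instruction; purely local work is merged into the preceding instruction. The first two
  arguments are the current \<open>v\<^sub>L\<close> and \<open>v\<^sub>R\<close>, the last one is the local variable \<open>c\<close> of the running search
  (where there is one), and the remaining argument of the states of SearchRight is the result \<open>p\<^sub>L\<close> of
  SearchLeft. \<open>TestUp\<close> reads the pointer for the loop condition, \<open>RetUp\<close> reads it for the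
  return value.\<close>

datatype 'p control =
    CasRight 'p 'p
  | SetLeft 'p 'p
  | TestUpL 'p 'p 'p
  | MoveLeft 'p 'p 'p
  | RetUpL 'p 'p 'p
  | TestUpR 'p 'p "'p option" 'p
  | MoveRight 'p 'p "'p option" 'p
  | RetUpR 'p 'p "'p option" 'p
  | Done

fun after_search :: "'p option \<Rightarrow> 'p option \<Rightarrow> 'p control" where
  "after_search (Some pL) (Some pR) = CasRight pL pR"
| "after_search _ _ = Done"

fun exec :: "'p control \<Rightarrow> 'p heap \<Rightarrow> 'p control \<times> 'p heap" where
  "exec (CasRight vL vR) m =
     (if ptr_right m vL = None
      then (SetLeft vL vR, m\<lparr>ptr_right := (ptr_right m)(vL := Some vR)\<rparr>)
      else (Done, m))"
| "exec (SetLeft vL vR) m =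
     (TestUpL vL vR vL, m\<lparr>ptr_left := (ptr_left m)(vR := Some vL)\<rparr>)"
| "exec (TestUpL vL vR c) m =
     (if ptr_up m c = None then MoveLeft vL vR c else RetUpL vL vR c, m)"
| "exec (MoveLeft vL vR c) m =
     (case ptr_left m c of
        None \<Rightarrow> TestUpR vL vR None vR
      | Some c' \<Rightarrow> if c' = vL then TestUpR vL vR None vR else TestUpL vL vR c', m)"
| "exec (RetUpL vL vR c) m = (TestUpR vL vR (ptr_up m c) vR, m)"
| "exec (TestUpR vL vR pL c) m =
     (if ptr_up m c = None then MoveRight vL vR pL c else RetUpR vL vR pL c, m)"
| "exec (MoveRight vL vR pL c) m =
     (case ptr_right m c of
        None \<Rightarrow> after_search pL None
      | Some c' \<Rightarrow> if c' = vR then after_search pL None else TestUpR vL vR pL c', m)"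
| "exec (RetUpR vL vR pL c) m = (after_search pL (ptr_up m c), m)"
| "exec Done m = (Done, m)"

text \<open>Linearizable memory instructions: a concurrent execution is an arbitrary interleaving of
  atomically executed instructions, with no fairness assumption on the scheduler.\<close>

inductive step :: "'p heap \<times> 'p control list \<Rightarrow> 'p heap \<times> 'p control list \<Rightarrow> bool" where
  "\<lbrakk>k < length cs; cs ! k \<noteq> Done; exec (cs ! k) m = (c', m')\<rbrakk> \<Longrightarrow>
   step (m, cs) (m', cs[k := c'])"

definition start_join :: "'e \<times> 'e \<Rightarrow> ('e \<times> nat) control" where
  "start_join b = CasRight (fst b, 1) (snd b, 1)"

inductive sequential_run ::
  "('e \<times> nat) heap \<Rightarrow> ('e \<times> 'e) list \<Rightarrow> ('e \<times> nat) heap \<Rightarrow> bool" where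
  Nil: "sequential_run m [] m"
| Cons: "\<lbrakk>step\<^sup>*\<^sup>* (m, [start_join b]) (m', [Done]); sequential_run m' B m''\<rbrakk> \<Longrightarrow>
    sequential_run m (b # B) m''"

end

theory Submission
  imports Defs
begin

text \<open>
  Let \<open>R\<close> be the right links of the valid skip list of the concatenated sequences. Two nodes are
  \<open>R\<close>-adjacent on level \<open>i + 1\<close> iff on level \<open>i\<close> a stretch of \<open>R\<close>-links without parents in its interior
  leads from one to the other. At any time every horizontal pointer is null or agrees with \<open>R\<close>;
  hence every search follows \<open>R\<close>, and a search on both sides of a link of \<open>R\<close> can only find two
  \<open>R\<close>-adjacent parents. So no wrong pointer is ever written.

  No link is missed either: among the threads that create links on a given stretch of level \<open>i\<close>, the
  last one to set its left pointer runs its searches on a complete stretch, finds both parents and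
  attempts the join above. By induction on the level the terminal heap has all links of \<open>R\<close>, and a
  valid heap is determined by its sequences and by its contents outside the nodes. The sequential
  execution is the special case of one thread, applied repeatedly.

  Termination: a thread climbs one level per recursive call, and a search walks along \<open>R\<close> without
  returning to its origin, hence visits each node at most once since \<open>R\<close> is injective.
\<close>

section \<open>Adjacency on the levels of a skip list\<close>

text \<open>From \<open>a\<close>, at least one \<open>G\<close>-step leads to the first point
  satisfying \<open>P\<close>. Whether \<open>P a\<close> holds is never tested, so \<open>a\<close>
  and \<open>b\<close> may coincide, as on a cycle with a single tall element.\<close>

inductive skip :: "('a \<Rightarrow> 'a \<Rightarrow> bool) \<Rightarrow> ('a \<Rightarrow> bool) \<Rightarrow> 'a \<Rightarrow> 'a \<Rightarrow> bool" for G P where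
  hit: "G a b \<Longrightarrow> P b \<Longrightarrow> skip G P a b"
| pass: "G a c \<Longrightarrow> \<not> P c \<Longrightarrow> skip G P c b \<Longrightarrow> skip G P a b"

lemma skip_functional:
  assumes "skip G P a b" "skip G P a c" "\<And>x y z. G x y \<Longrightarrow> G x z \<Longrightarrow> y = z"
  shows "b = c"
  using assms(1,2)
proof (induction rule: skip.induct)
  case (hit a b)
  from hit(3) show ?case by (cases) (use hit assms(3) in blast)+
next
  case (pass a d b)
  from pass(5) show ?case by (cases) (use pass assms(3) in blast)+
qed

lemma skip_mono:
  assumes "skip G P a b" "\<And>x y. G x y \<Longrightarrow> G' x y"
  shows "skip G' P a b"
  using assms(1) by (induction rule: skip.induct) (auto intro: skip.intros assms(2))

lemma skip_path:
  assumes "successively G (a # ms @ [b])" "\<forall>x\<in>set ms. \<not> P x" "P b"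
  shows "skip G P a b"
  using assms by (induction ms arbitrary: a) (auto intro: skip.intros)

section \<open>Adjacency in one sequence and in its level sublists\<close>

definition adj :: "'e sequence \<Rightarrow> 'e \<Rightarrow> 'e \<Rightarrow> bool" where
  "adj s a b \<longleftrightarrow> (\<exists>j<length (elems s). elems s ! j = a \<and> next_elem s j = Some b)"

lemma nth_Suc_iff_append:
  "(\<exists>j. Suc j < length xs \<and> xs ! j = a \<and> xs ! Suc j = b) \<longleftrightarrow> (\<exists>us vs. xs = us @ a # b # vs)"
proof
  assume "\<exists>j. Suc j < length xs \<and> xs ! j = a \<and> xs ! Suc j = b"
  then obtain j where "Suc j < length xs" "xs ! j = a" "xs ! Suc j = b" by blast
  then have "xs = take j xs @ a # b # drop (Suc (Suc j)) xs"
    by (metis Cons_nth_drop_Suc Suc_lessD append_take_drop_id)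
  then show "\<exists>us vs. xs = us @ a # b # vs" by blast
next
  assume "\<exists>us vs. xs = us @ a # b # vs"
  then obtain us vs where "xs = us @ a # b # vs" by blast
  then show "\<exists>j. Suc j < length xs \<and> xs ! j = a \<and> xs ! Suc j = b"
    by (intro exI[of _ "length us"]) (auto simp: nth_append)
qed

lemma adj_Linear: "adj (Linear xs) a b \<longleftrightarrow> (\<exists>us vs. xs = us @ a # b # vs)"
  unfolding nth_Suc_iff_append[symmetric] adj_def by (auto split: if_splits)

lemma adj_Cyclic:
  "adj (Cyclic xs) a b \<longleftrightarrow> (\<exists>us vs. xs = us @ a # b # vs) \<or> (xs \<noteq> [] \<and> a = last xs \<and> b = hd xs)"
proof -
  have "adj (Cyclic xs) a b \<longleftrightarrow>
    (\<exists>j. Suc j < length xs \<and> xs ! j = a \<and> xs ! Suc j = b) \<or> (xs \<noteq> [] \<and> a = last xs \<and> b = hd xs)"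
  proof
    assume "adj (Cyclic xs) a b"
    then obtain j where j: "j < length xs" "xs ! j = a" "xs ! (Suc j mod length xs) = b"
      by (auto simp: adj_def)
    show "(\<exists>j. Suc j < length xs \<and> xs ! j = a \<and> xs ! Suc j = b) \<or> (xs \<noteq> [] \<and> a = last xs \<and> b = hd xs)"
    proof (cases "Suc j < length xs")
      case False
      then have "Suc j = length xs" using j by simp
      then show ?thesis using j
        by (metis diff_Suc_1 hd_conv_nth last_conv_nth length_0_conv less_zeroE mod_self)
    qed (use j in auto)
  next
    assume "(\<exists>j. Suc j < length xs \<and> xs ! j = a \<and> xs ! Suc j = b) \<or> (xs \<noteq> [] \<and> a = last xs \<and> b = hd xs)"
    then show "adj (Cyclic xs) a b"
    proof
      assume "\<exists>j. Suc j < length xs \<and> xs ! j = a \<and> xs ! Suc j = b"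
      then obtain j where "Suc j < length xs" "xs ! j = a" "xs ! Suc j = b" by blast
      then show ?thesis by (auto simp: adj_def intro!: exI[of _ j])
    next
      assume "xs \<noteq> [] \<and> a = last xs \<and> b = hd xs"
      then show ?thesis
        by (auto simp: adj_def last_conv_nth hd_conv_nth intro!: exI[of _ "length xs - 1"])
    qed
  qed
  then show ?thesis unfolding nth_Suc_iff_append .
qed

lemma adj_elems: "adj s a b \<Longrightarrow> a \<in> set (elems s) \<and> b \<in> set (elems s)"
  by (cases s) (auto simp: adj_Linear adj_Cyclic)

lemma next_elem_eq_Some_iff:
  assumes "distinct (elems s)" "j < length (elems s)"
  shows "next_elem s j = Some b \<longleftrightarrow> adj s (elems s ! j) b"
  using assms by (auto simp: adj_def nth_eq_iff_index_eq)

text \<open>Left pointers are specified by separate index arithmetic; this reduces them to the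
  relation behind the right pointers, read backwards.\<close>

lemma prev_elem_eq_Some_iff:
  assumes "distinct (elems s)" "j < length (elems s)"
  shows "prev_elem s j = Some a \<longleftrightarrow> adj s a (elems s ! j)"
proof (cases s)
  case (Linear xs)
  have "prev_elem s j = Some a \<longleftrightarrow> (\<exists>k. Suc k = j \<and> xs ! k = a)"
    using Linear by (cases j) auto
  also have "\<dots> \<longleftrightarrow> adj s a (elems s ! j)"
    using Linear assms by (auto simp: adj_def nth_eq_iff_index_eq split: if_splits)
  finally show ?thesis .
next
  case (Cyclic xs)
  let ?n = "length xs"
  \<comment> \<open>On the indices below \<open>?n\<close>, cyclic predecessor and cyclic successor
    are inverse to each other; the case splits isolate the two wrap-around positions.\<close>
  have *: "k = (j + ?n - 1) mod ?n \<longleftrightarrow> Suc k mod ?n = j" if "k < ?n" for k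
    using that assms(2) Cyclic by (cases "Suc k = ?n"; cases j) (auto simp: mod_Suc)
  have n: "(j + ?n - 1) mod ?n < ?n" using assms(2) Cyclic by (cases ?n) auto
  have "prev_elem s j = Some a \<longleftrightarrow> (\<exists>k<?n. k = (j + ?n - 1) mod ?n \<and> xs ! k = a)"
    using n Cyclic by auto
  also have "\<dots> \<longleftrightarrow> (\<exists>k<?n. Suc k mod ?n = j \<and> xs ! k = a)" using * by blast
  also have "\<dots> \<longleftrightarrow> (\<exists>k<?n. xs ! (Suc k mod ?n) = xs ! j \<and> xs ! k = a)"
    using assms Cyclic by (metis length_pos_if_in_set mod_less_divisor nth_eq_iff_index_eq nth_mem sequence.sel(2))
  also have "\<dots> \<longleftrightarrow> adj s a (elems s ! j)" using Cyclic by (auto simp: adj_def)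
  finally show ?thesis .
qed

lemma adj_functional: "distinct (elems s) \<Longrightarrow> adj s a b \<Longrightarrow> adj s a c \<Longrightarrow> b = c"
  by (auto simp: adj_def nth_eq_iff_index_eq)

lemma adj_injective: "distinct (elems s) \<Longrightarrow> adj s a c \<Longrightarrow> adj s b c \<Longrightarrow> a = b"
  by (metis adj_elems in_set_conv_nth option.inject prev_elem_eq_Some_iff)

lemma elems_at_level: "elems (at_level h i s) = filter (\<lambda>e. i \<le> h e) (elems s)"
  by (cases s) auto

lemma at_level_at_level: "i \<le> j \<Longrightarrow> at_level h j (at_level h i s) = at_level h j s"
  by (cases s) (auto intro!: filter_cong)

lemma at_level_1: "\<forall>e\<in>set (elems s). 1 \<le> h e \<Longrightarrow> at_level h 1 s = s"
  by (cases s) auto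

text \<open>Supplies the path that \<open>skip_path\<close> asks for: whatever stood between two
  consecutive survivors of a filter was removed by it.\<close>

lemma filter_eq_two:
  assumes "filter P xs = us @ a # b # vs"
  shows "\<exists>us' ms vs'. xs = us' @ a # ms @ b # vs' \<and> (\<forall>x\<in>set ms. \<not> P x) \<and> P b"
proof -
  have "\<exists>u w. xs = u @ w \<and> filter P w = a # b # vs"
    using assms
  proof (induction us arbitrary: xs)
    case (Cons c us)
    then obtain u w where "xs = u @ c # w" "filter P w = us @ a # b # vs"
      by (auto simp: filter_eq_Cons_iff)
    then show ?case using Cons.IH[of w] by (metis append.assoc append_Cons)
  qed auto
  then obtain u w where "xs = u @ w" "filter P w = a # b # vs" by blast
  moreover then obtain u1 w1 where "w = u1 @ a # w1" "filter P w1 = b # vs"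
    by (metis filter_eq_Cons_iff)
  moreover then obtain u2 w2 where "w1 = u2 @ b # w2" "\<forall>x\<in>set u2. \<not> P x" "P b"
    by (auto simp: filter_eq_Cons_iff)
  ultimately show ?thesis by (metis append.assoc)
qed

lemma successively_adj_Linear: "successively (adj (Linear xs)) xs"
proof -
  have "successively (adj (Linear (us @ ys))) ys" for us ys :: "'a list"
  proof (induction ys arbitrary: us)
    case (Cons y ys)
    show ?case using Cons[of "us @ [y]"] by (cases ys) (auto simp: adj_Linear)
  qed simp
  from this[of "[]"] show ?thesis by simp
qed

lemma successively_adj: "successively (adj s) (elems s)"
proof (cases s)
  case (Cyclic xs)
  then show ?thesis using successively_adj_Linear[of xs]
    by (auto simp: adj_Linear adj_Cyclic elim!: successively_mono)
qed (use successively_adj_Linear in auto)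

lemma adj_at_levelD:
  assumes "adj (at_level h i s) a b"
  shows "i \<le> h a \<and> skip (adj s) (\<lambda>e. i \<le> h e) a b"
proof
  let ?P = "\<lambda>e. i \<le> h e"
  show "?P a" using adj_elems[OF assms] by (auto simp: elems_at_level)
  have inner: "skip (adj s) ?P a b" if "filter ?P (elems s) = us @ a # b # vs" for us vs
  proof -
    from filter_eq_two[OF that] obtain us' ms vs' where
      *: "elems s = us' @ a # ms @ b # vs'" "\<forall>x\<in>set ms. \<not> ?P x" "?P b" by blast
    have "elems s = us' @ (a # ms @ [b]) @ vs'" using * by simp
    then have "successively (adj s) (a # ms @ [b])"
      using successively_adj[of s] by (metis successively_append_iff)
    then show ?thesis using * by (intro skip_path)
  qed
  show "skip (adj s) ?P a b"
  proof (cases s)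
    case (Linear xs)
    then show ?thesis using assms inner by (auto simp: adj_Linear)
  next
    case (Cyclic xs)
    from assms consider us vs where "filter ?P xs = us @ a # b # vs"
      | "filter ?P xs \<noteq> []" "a = last (filter ?P xs)" "b = hd (filter ?P xs)"
      by (auto simp: adj_Cyclic Cyclic)
    then show ?thesis
    proof cases
      case 1
      then show ?thesis using inner Cyclic by auto
    next
      \<comment> \<open>The wrap-around link: the path runs from the last survivor to the end of
        \<open>xs\<close>, over the closing link, and from the head of \<open>xs\<close> to the
        first survivor.\<close>
      case 2
      obtain vs where "filter ?P xs = b # vs" using 2 by (cases "filter ?P xs") auto
      then obtain m1 w1 where 1: "xs = m1 @ b # w1" "\<forall>x\<in>set m1. \<not> ?P x" "?P b"
        by (auto simp: filter_eq_Cons_iff)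
      \<comment> \<open>Reversal makes the last survivor the first one, so that
        \<open>filter_eq_Cons_iff\<close> can locate it.\<close>
      have "rev (filter ?P xs) = a # rev (butlast (filter ?P xs))"
        using 2 by (metis append_butlast_last_id rev_eq_Cons_iff rev_rev_ident)
      then have "filter ?P (rev xs) = a # rev (butlast (filter ?P xs))" by (simp add: rev_filter)
      then obtain m2 w2 where 2: "rev xs = m2 @ a # w2" "\<forall>x\<in>set m2. \<not> ?P x"
        by (auto simp: filter_eq_Cons_iff)
      then have 3: "xs = rev w2 @ a # rev m2" by (metis append.assoc append_Cons append_Nil rev.simps(2) rev_append rev_rev_ident)
      have s1: "successively (adj s) (m1 @ [b])"
        using successively_adj[of s] 1 Cyclic
        by (metis append.assoc append_Cons append_Nil sequence.sel(2) successively_append_iff)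
      have s2: "successively (adj s) (a # rev m2)"
        using successively_adj[of s] 3 Cyclic by (metis sequence.sel(2) successively_append_iff)
      have "last (a # rev m2) = last xs" "hd (m1 @ [b]) = hd xs" "xs \<noteq> []"
        by (simp add: 3, simp add: 1(1) hd_append, simp add: 3)
      then have "adj s (last (a # rev m2)) (hd (m1 @ [b]))" by (simp add: Cyclic adj_Cyclic)
      then have "successively (adj s) ((a # rev m2) @ (m1 @ [b]))"
        using s1 s2 by (simp add: successively_append_iff del: append_Cons)
      then show ?thesis using 1 2 by (intro skip_path[of _ _ "rev m2 @ m1"]) auto
    qed
  qed
qed

text \<open>Since \<open>xs\<close> is distinct, each step of the walk must move one place into the
  suffix \<open>ms\<close>. No point of \<open>ms\<close> satisfies \<open>P\<close>, so the walk
  runs off the end before it can stop.\<close>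

lemma skip_adj_Linear_suffix:
  assumes "skip (adj (Linear xs)) P a b" "distinct xs" "xs = us @ a # ms" "\<forall>x\<in>set ms. \<not> P x"
  shows False
  using assms
proof (induction arbitrary: us ms rule: skip.induct)
  case (hit a b)
  then obtain us' vs where "xs = us' @ a # b # vs" by (auto simp: adj_Linear)
  with hit have "ms = b # vs"
    by (metis append_Cons_eq_iff distinct.simps(2) distinct_append not_distinct_conv_prefix disjoint_iff list.set_intros(1))
  then show ?case using hit by auto
next
  case (pass a c b)
  then obtain us' vs where "xs = us' @ a # c # vs" by (auto simp: adj_Linear)
  with pass have "ms = c # vs"
    by (metis append_Cons_eq_iff distinct.simps(2) distinct_append not_distinct_conv_prefix disjoint_iff list.set_intros(1))
  then show ?case using pass.IH[of "us @ [a]" vs] pass.prems by auto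
qed

lemma adj_at_level:
  assumes "distinct (elems s)"
  shows "adj (at_level h i s) a b \<longleftrightarrow> i \<le> h a \<and> skip (adj s) (\<lambda>e. i \<le> h e) a b"
proof
  let ?P = "\<lambda>e. i \<le> h e"
  assume r: "i \<le> h a \<and> skip (adj s) ?P a b"
  then have "a \<in> set (elems s)" by (auto elim: skip.cases dest: adj_elems)
  then have "a \<in> set (filter ?P (elems s))" using r by auto
  then obtain us vs where f: "filter ?P (elems s) = us @ a # vs" by (meson split_list)
  \<comment> \<open>Some neighbour suffices, because \<open>skip_functional\<close> then identifies
    it with \<open>b\<close>. Only the last survivor of a linear sequence has none, and
    \<open>skip_adj_Linear_suffix\<close> excludes that case.\<close>
  have "\<exists>c. adj (at_level h i s) a c"
  proof (cases vs)
    case (Cons c ws)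
    then show ?thesis using f by (cases s) (auto simp: adj_Linear adj_Cyclic)
  next
    case Nil
    show ?thesis
    proof (cases s)
      case (Linear xs)
      have "filter ?P (rev xs) = a # rev us" using f Nil Linear by (simp flip: rev_filter)
      then obtain m2 w2 where "rev xs = m2 @ a # w2" "\<forall>x\<in>set m2. \<not> ?P x"
        by (auto simp: filter_eq_Cons_iff)
      then have "xs = rev w2 @ a # rev m2" "\<forall>x\<in>set (rev m2). \<not> ?P x"
        by (metis append.assoc append_Cons append_Nil rev.simps(2) rev_append rev_rev_ident, simp)
      then have False
        using skip_adj_Linear_suffix[of xs ?P a b "rev w2" "rev m2"] r assms Linear by simp
      then show ?thesis ..
    next
      case (Cyclic xs)
      then show ?thesis using f Nil by (auto simp: adj_Cyclic)
    qed
  qed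
  then obtain c where c: "adj (at_level h i s) a c" by blast
  then have "skip (adj s) ?P a c" using adj_at_levelD[of h i s a c] by simp
  with r have "b = c" using assms by (blast intro: skip_functional adj_functional)
  with c show "adj (at_level h i s) a b" by simp
qed (rule adj_at_levelD)

section \<open>Adjacency in a collection of disjoint sequences\<close>

definition elements :: "'e sequence set \<Rightarrow> 'e set" where
  "elements S = (\<Union>s\<in>S. set (elems s))"

definition level_adj :: "('e \<Rightarrow> nat) \<Rightarrow> 'e sequence set \<Rightarrow> nat \<Rightarrow> 'e \<Rightarrow> 'e \<Rightarrow> bool" where
  "level_adj h S i a b \<longleftrightarrow> (\<exists>s\<in>S. adj (at_level h i s) a b)"

lemma well_formed_same:
  "well_formed S \<Longrightarrow> s \<in> S \<Longrightarrow> t \<in> S \<Longrightarrow> a \<in> set (elems s) \<Longrightarrow> a \<in> set (elems t) \<Longrightarrow> s = t"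
  unfolding well_formed_def by blast

lemma adj_at_level_elems:
  "adj (at_level h i s) a b \<Longrightarrow> a \<in> set (elems s) \<and> b \<in> set (elems s) \<and> i \<le> h a \<and> i \<le> h b"
  by (auto dest!: adj_elems simp: elems_at_level)

lemma distinct_at_level: "well_formed S \<Longrightarrow> s \<in> S \<Longrightarrow> distinct (elems (at_level h i s))"
  by (auto simp: well_formed_def elems_at_level)

lemma level_adj_elements:
  "level_adj h S i a b \<Longrightarrow> a \<in> elements S \<and> b \<in> elements S \<and> i \<le> h a \<and> i \<le> h b"
  unfolding level_adj_def elements_def using adj_at_level_elems by fastforce

lemma level_adj_functional:
  assumes "well_formed S" "level_adj h S i a b" "level_adj h S i a c"
  shows "b = c"
proof -
  obtain s t where "s \<in> S" "adj (at_level h i s) a b" "t \<in> S" "adj (at_level h i t) a c"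
    using assms by (auto simp: level_adj_def)
  moreover then have "s = t" using assms(1) adj_at_level_elems well_formed_same by metis
  ultimately show ?thesis using adj_functional distinct_at_level assms(1) by metis
qed

lemma level_adj_injective:
  assumes "well_formed S" "level_adj h S i a c" "level_adj h S i b c"
  shows "a = b"
proof -
  obtain s t where "s \<in> S" "adj (at_level h i s) a c" "t \<in> S" "adj (at_level h i t) b c"
    using assms by (auto simp: level_adj_def)
  moreover then have "s = t" using assms(1) adj_at_level_elems well_formed_same by metis
  ultimately show ?thesis using adj_injective distinct_at_level assms(1) by metis
qed

text \<open>Each level is determined by the one below it, which is the form in which a join climbs.
  The converse direction has to keep the walk inside one sequence; disjointness guarantees
  this.\<close>

lemma level_adj_Suc:
  assumes "well_formed S"
  shows "level_adj h S (Suc i) a b \<longleftrightarrow> Suc i \<le> h a \<and> skip (level_adj h S i) (\<lambda>e. Suc i \<le> h e) a b"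
proof
  assume "level_adj h S (Suc i) a b"
  then obtain s where s: "s \<in> S" "adj (at_level h (Suc i) (at_level h i s)) a b"
    by (auto simp: level_adj_def at_level_at_level)
  then have "Suc i \<le> h a \<and> skip (adj (at_level h i s)) (\<lambda>e. Suc i \<le> h e) a b"
    using adj_at_levelD by metis
  then show "Suc i \<le> h a \<and> skip (level_adj h S i) (\<lambda>e. Suc i \<le> h e) a b"
    using s(1) by (auto simp: level_adj_def elim!: skip_mono)
next
  assume r: "Suc i \<le> h a \<and> skip (level_adj h S i) (\<lambda>e. Suc i \<le> h e) a b"
  then have "skip (level_adj h S i) (\<lambda>e. Suc i \<le> h e) a b" ..
  then have "\<exists>s\<in>S. a \<in> set (elems s) \<and> skip (adj (at_level h i s)) (\<lambda>e. Suc i \<le> h e) a b"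
  proof (induction rule: skip.induct)
    case (hit a b)
    then show ?case by (auto simp: level_adj_def dest: adj_at_level_elems intro: skip.hit)
  next
    case (pass a c b)
    then obtain s t where "s \<in> S" "c \<in> set (elems s)" "skip (adj (at_level h i s)) (\<lambda>e. Suc i \<le> h e) c b"
      "t \<in> S" "adj (at_level h i t) a c" by (auto simp: level_adj_def)
    moreover then have "s = t" using assms(1) adj_at_level_elems well_formed_same by metis
    ultimately show ?case using pass(2) adj_at_level_elems skip.pass by metis
  qed
  then obtain s where "s \<in> S" "skip (adj (at_level h i s)) (\<lambda>e. Suc i \<le> h e) a b" by blast
  then have "adj (at_level h (Suc i) (at_level h i s)) a b"
    using r adj_at_level[OF distinct_at_level[OF assms]] by blast
  then show "level_adj h S (Suc i) a b"
    using \<open>s \<in> S\<close> by (auto simp: level_adj_def at_level_at_level)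
qed

lemma level_adj_1: "\<forall>e\<in>elements S. 1 \<le> h e \<Longrightarrow> level_adj h S 1 a b \<longleftrightarrow> (\<exists>s\<in>S. adj s a b)"
  using at_level_1[of _ h] by (auto simp: level_adj_def elements_def)

text \<open>By \<open>level_adj_Suc\<close> all levels are built from level 1, and
  \<open>skip\<close> is monotone in its relation.\<close>

lemma level_adj_mono:
  assumes "well_formed S" "well_formed S'" "\<And>a b. level_adj h S 1 a b \<Longrightarrow> level_adj h S' 1 a b"
    "1 \<le> i" "level_adj h S i a b"
  shows "level_adj h S' i a b"
  using assms(4,5)
proof (induction i arbitrary: a b rule: dec_induct)
  case base
  then show ?case using assms(3) by simp
next
  case (step i)
  then show ?case by (auto simp: level_adj_Suc assms(1,2) elim!: skip_mono)
qed

lemma linked_at_iff: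
  assumes "distinct (elems s)"
  shows "linked_at m i s \<longleftrightarrow> (\<forall>e\<in>set (elems s). \<forall>q.
    (ptr_right m (e, i) = Some q \<longleftrightarrow> (\<exists>b. q = (b, i) \<and> adj s e b)) \<and>
    (ptr_left m (e, i) = Some q \<longleftrightarrow> (\<exists>b. q = (b, i) \<and> adj s b e)))"
proof -
  have eq: "x = map_option (\<lambda>e. (e, i)) y \<longleftrightarrow> (\<forall>q. x = Some q \<longleftrightarrow> (\<exists>b. q = (b, i) \<and> y = Some b))"
    for x :: "('a \<times> nat) option" and y
    by (cases x; cases y) auto
  have "linked_at m i s \<longleftrightarrow> (\<forall>j<length (elems s). \<forall>q.
    (ptr_right m (elems s ! j, i) = Some q \<longleftrightarrow> (\<exists>b. q = (b, i) \<and> adj s (elems s ! j) b)) \<and>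
    (ptr_left m (elems s ! j, i) = Some q \<longleftrightarrow> (\<exists>b. q = (b, i) \<and> adj s b (elems s ! j))))"
    unfolding linked_at_def eq
    by (auto simp: next_elem_eq_Some_iff prev_elem_eq_Some_iff assms)
  also have "\<dots> \<longleftrightarrow> (\<forall>e\<in>set (elems s). \<forall>q.
    (ptr_right m (e, i) = Some q \<longleftrightarrow> (\<exists>b. q = (b, i) \<and> adj s e b)) \<and>
    (ptr_left m (e, i) = Some q \<longleftrightarrow> (\<exists>b. q = (b, i) \<and> adj s b e)))"
    by (auto simp: all_set_conv_all_nth)
  finally show ?thesis .
qed

section \<open>Validity expressed by a single relation on nodes\<close>

definition nodes :: "('e \<Rightarrow> nat) \<Rightarrow> 'e sequence set \<Rightarrow> ('e \<times> nat) set" where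
  "nodes h S = {(e, i). e \<in> elements S \<and> 1 \<le> i \<and> i \<le> h e}"

text \<open>The bound \<open>1 \<le> snd p\<close> matters: \<open>level_adj\<close> at level 0
  would link addresses that are not allocated.\<close>

definition node_adj ::
  "('e \<Rightarrow> nat) \<Rightarrow> 'e sequence set \<Rightarrow> ('e \<times> nat) \<Rightarrow> ('e \<times> nat) \<Rightarrow> bool" where
  "node_adj h S p q \<longleftrightarrow> snd p = snd q \<and> 1 \<le> snd p \<and> level_adj h S (snd p) (fst p) (fst q)"

definition horizontally_linked ::
  "('p \<Rightarrow> 'p \<Rightarrow> bool) \<Rightarrow> 'p set \<Rightarrow> 'p heap \<Rightarrow> bool" where
  "horizontally_linked R A m \<longleftrightarrow> (\<forall>p\<in>A. \<forall>q.
    (ptr_right m p = Some q \<longleftrightarrow> R p q) \<and> (ptr_left m p = Some q \<longleftrightarrow> R q p))"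

lemma level_adj_local:
  assumes "well_formed S" "s \<in> S" "e \<in> set (elems s)"
  shows "level_adj h S i e b \<longleftrightarrow> adj (at_level h i s) e b"
    and "level_adj h S i b e \<longleftrightarrow> adj (at_level h i s) b e"
  using assms adj_at_level_elems well_formed_same unfolding level_adj_def by metis+

lemma valid_skip_list_iff:
  "valid_skip_list h S m \<longleftrightarrow> well_formed S \<and>
     (\<forall>e\<in>elements S. 1 \<le> h e) \<and>
     (\<forall>(e, i)\<in>nodes h S. ptr_up m (e, i) = (if i < h e then Some (e, i + 1) else None) \<and>
           ptr_down m (e, i) = (if 1 < i then Some (e, i - 1) else None)) \<and>
     horizontally_linked (node_adj h S) (nodes h S) m"
proof (cases "well_formed S")
  case True
  define Q where "Q = (\<lambda>p. \<forall>q. (ptr_right m p = Some q \<longleftrightarrow> node_adj h S p q) \<and>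
    (ptr_left m p = Some q \<longleftrightarrow> node_adj h S q p))"
  have "linked_at m i (at_level h i s) \<longleftrightarrow> (\<forall>e\<in>set (elems s). i \<le> h e \<longrightarrow> Q (e, i))"
    if "s \<in> S" "1 \<le> i" for s i
    unfolding linked_at_iff[OF distinct_at_level[OF True that(1)]] Q_def
    using level_adj_local[OF True that(1)] that(2)
    by (auto simp: elems_at_level node_adj_def)
  then have "(\<forall>s\<in>S. \<forall>i\<ge>1. linked_at m i (at_level h i s)) \<longleftrightarrow> (\<forall>p\<in>nodes h S. Q p)"
    unfolding nodes_def elements_def by (simp add: split_paired_all) blast
  then have *: "(\<forall>s\<in>S. \<forall>i\<ge>1. linked_at m i (at_level h i s)) \<longleftrightarrow>
    horizontally_linked (node_adj h S) (nodes h S) m"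
    unfolding horizontally_linked_def Q_def .
  define V where "V = (\<lambda>(e, i). ptr_up m (e, i) = (if i < h e then Some (e, i + 1) else None) \<and>
           ptr_down m (e, i) = (if 1 < i then Some (e, i - 1) else None))"
  have "(\<forall>s\<in>S. \<forall>e\<in>set (elems s). 1 \<le> h e \<and> (\<forall>i\<in>{1..h e}. V (e, i))) \<longleftrightarrow>
     (\<forall>e\<in>elements S. 1 \<le> h e) \<and> (\<forall>p\<in>nodes h S. V p)"
    unfolding nodes_def elements_def by (simp add: split_paired_all Ball_def) blast
  then have **: "(\<forall>s\<in>S. \<forall>e\<in>set (elems s). 1 \<le> h e \<and>
        (\<forall>i\<in>{1..h e}.
           ptr_up m (e, i) = (if i < h e then Some (e, i + 1) else None) \<and>
           ptr_down m (e, i) = (if 1 < i then Some (e, i - 1) else None))) \<longleftrightarrow>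
     (\<forall>e\<in>elements S. 1 \<le> h e) \<and>
     (\<forall>(e, i)\<in>nodes h S. ptr_up m (e, i) = (if i < h e then Some (e, i + 1) else None) \<and>
           ptr_down m (e, i) = (if 1 < i then Some (e, i - 1) else None))"
    unfolding V_def prod.case .
  show ?thesis unfolding valid_skip_list_def * ** using True by blast
qed (simp add: valid_skip_list_def)

text \<open>An option is determined by the values \<open>q\<close> for which it equals
  \<open>Some q\<close>; having no such \<open>q\<close> means \<open>None\<close>.\<close>

lemma horizontally_linked_unique:
  assumes "horizontally_linked R A m" "horizontally_linked R A m'"
    "\<forall>p. p \<notin> A \<longrightarrow> ptr_right m p = ptr_right m' p \<and> ptr_left m p = ptr_left m' p"
    "ptr_up m = ptr_up m'" "ptr_down m = ptr_down m'"
  shows "m = m'"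
proof -
  have "ptr_right m p = ptr_right m' p" for p
    using assms(1-3) unfolding horizontally_linked_def
    by (cases "p \<in> A") (metis not_Some_eq, simp)
  moreover have "ptr_left m p = ptr_left m' p" for p
    using assms(1-3) unfolding horizontally_linked_def
    by (cases "p \<in> A") (metis not_Some_eq, simp)
  ultimately show ?thesis using assms(4,5) by (auto intro!: heap.equality)
qed

section \<open>Effect of joins on sequences and adjacency\<close>

lemma adj_Linear_append:
  assumes "xs \<noteq> []" "ys \<noteq> []"
  shows "adj (Linear (xs @ ys)) a b \<longleftrightarrow>
    adj (Linear xs) a b \<or> adj (Linear ys) a b \<or> (a = last xs \<and> b = hd ys)"
proof
  assume "adj (Linear (xs @ ys)) a b"
  then obtain us vs where "xs @ ys = us @ a # b # vs" by (auto simp: adj_Linear)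
  then consider w where "ys = w @ a # b # vs" | "xs = us @ [a]" "ys = b # vs"
    | w where "xs = us @ a # b # w"
    by (auto simp: append_eq_append_conv2 append_eq_Cons_conv)
  then show "adj (Linear xs) a b \<or> adj (Linear ys) a b \<or> (a = last xs \<and> b = hd ys)"
    unfolding adj_Linear by cases auto
next
  assume "adj (Linear xs) a b \<or> adj (Linear ys) a b \<or> (a = last xs \<and> b = hd ys)"
  then consider us vs where "xs = us @ a # b # vs" | us vs where "ys = us @ a # b # vs"
    | "a = last xs" "b = hd ys" by (auto simp: adj_Linear)
  then show "adj (Linear (xs @ ys)) a b"
  proof cases
    case 1
    then show ?thesis by (auto simp: adj_Linear)
  next
    case (2 us vs)
    then have "xs @ ys = (xs @ us) @ a # b # vs" by simp
    then show ?thesis unfolding adj_Linear by blast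
  next
    case 3
    then have "xs @ ys = butlast xs @ a # b # tl ys" using assms by simp
    then show ?thesis unfolding adj_Linear by blast
  qed
qed

lemma adj_Cyclic_Linear:
  "xs \<noteq> [] \<Longrightarrow> adj (Cyclic xs) a b \<longleftrightarrow> adj (Linear xs) a b \<or> (a = last xs \<and> b = hd xs)"
  by (auto simp: adj_Cyclic adj_Linear)

text \<open>Seen through adjacency, both kinds of join do the same thing: they add the one pair
  \<open>b\<close>. This removes the distinction between concatenating and closing from the rest of
  the proof.\<close>

lemma join_sequences_props:
  assumes "join_sequences S b S'" "well_formed S"
  shows "well_formed S'" "elements S' = elements S"
    "(\<exists>s\<in>S'. adj s u v) \<longleftrightarrow> (\<exists>s\<in>S. adj s u v) \<or> (u, v) = b"
proof -
  have ne: "xs \<noteq> []" if "Linear xs \<in> S" for xs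
    using that assms(2) by (force simp: well_formed_def)
  have wf: "elems s \<noteq> [] \<and> distinct (elems s)" if "s \<in> S" for s
    using that assms(2) by (simp add: well_formed_def)
  have disj: "set (elems s) \<inter> set (elems t) = {}" if "s \<in> S" "t \<in> S" "s \<noteq> t" for s t
    using that assms(2) by (simp add: well_formed_def)
  have well_formed_insert: "well_formed (insert t (S - T))"
    if "elems t \<noteq> []" "distinct (elems t)"
      "\<And>s. s \<in> S - T \<Longrightarrow> set (elems s) \<inter> set (elems t) = {}" for t T
    using that assms(2) unfolding well_formed_def by (simp add: ball_Un) blast
  have "well_formed S' \<and> elements S' = elements S \<and>
    ((\<exists>s\<in>S'. adj s u v) \<longleftrightarrow> (\<exists>s\<in>S. adj s u v) \<or> (u, v) = b)"
    using assms(1)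
  proof cases
    case (concat xs ys x y)
    let ?T = "S - {Linear xs, Linear ys}"
    have S: "S = insert (Linear xs) (insert (Linear ys) ?T)" using concat by auto
    have "well_formed S'"
      unfolding concat(2) by (rule well_formed_insert) 
        (use wf[of "Linear xs"] wf[of "Linear ys"] disj[of "Linear xs" "Linear ys"] disj[of _ "Linear xs"]
          disj[of _ "Linear ys"] concat in \<open>auto simp: Int_Un_distrib\<close>)
    moreover have "elements S' = elements S"
      unfolding concat(2) by (subst (2) S) (auto simp: elements_def)
    moreover have "(\<exists>s\<in>S'. adj s u v) \<longleftrightarrow> (\<exists>s\<in>?T. adj s u v) \<or> adj (Linear (xs @ ys)) u v"
      unfolding concat(2) by blast
    moreover have "(\<exists>s\<in>S. adj s u v) \<longleftrightarrow> (\<exists>s\<in>?T. adj s u v) \<or> adj (Linear xs) u v \<or> adj (Linear ys) u v"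
      by (subst S) blast
    ultimately show ?thesis using concat adj_Linear_append[OF ne[of xs] ne[of ys]] by auto
  next
    case (close xs x y)
    let ?T = "S - {Linear xs}"
    have S: "S = insert (Linear xs) ?T" using close by auto
    have "well_formed S'"
      unfolding close(2) by (rule well_formed_insert) 
        (use wf[of "Linear xs"] disj[of _ "Linear xs"] close in auto)
    moreover have "elements S' = elements S"
      unfolding close(2) by (subst (2) S) (auto simp: elements_def)
    moreover have "(\<exists>s\<in>S'. adj s u v) \<longleftrightarrow> (\<exists>s\<in>?T. adj s u v) \<or> adj (Cyclic xs) u v"
      unfolding close(2) by blast
    moreover have "(\<exists>s\<in>S. adj s u v) \<longleftrightarrow> (\<exists>s\<in>?T. adj s u v) \<or> adj (Linear xs) u v"
      by (subst S) blast
    ultimately show ?thesis using close adj_Cyclic_Linear[OF ne[of xs]] by auto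
  qed
  then show "well_formed S'" "elements S' = elements S"
    "(\<exists>s\<in>S'. adj s u v) \<longleftrightarrow> (\<exists>s\<in>S. adj s u v) \<or> (u, v) = b" by blast+
qed

lemma join_all_props:
  assumes "join_all S B S'" "well_formed S"
  shows "well_formed S'" "elements S' = elements S"
    "(\<exists>s\<in>S'. adj s u v) \<longleftrightarrow> (\<exists>s\<in>S. adj s u v) \<or> (u, v) \<in> set B"
proof -
  have "well_formed S' \<and> elements S' = elements S \<and>
    ((\<exists>s\<in>S'. adj s u v) \<longleftrightarrow> (\<exists>s\<in>S. adj s u v) \<or> (u, v) \<in> set B)"
    using assms
  proof (induction rule: join_all.induct)
    case (Cons S b S' B S'')
    then show ?case using join_sequences_props[OF Cons(1,4)] by auto
  qed auto
  then show "well_formed S'" "elements S' = elements S"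
    "(\<exists>s\<in>S'. adj s u v) \<longleftrightarrow> (\<exists>s\<in>S. adj s u v) \<or> (u, v) \<in> set B" by blast+
qed

text \<open>A join consumes only the last end \<open>x\<close> and the first end \<open>y\<close>.
  The other inputs use different ends, and these are still ends of linear sequences
  afterwards.\<close>

lemma join_sequences_exists:
  assumes "well_formed S" "valid_join_inputs S (b # B)"
  obtains S' where "join_sequences S b S'" "valid_join_inputs S' B"
proof -
  obtain x y where b: "b = (x, y)" by (cases b)
  obtain xs ys where *: "Linear xs \<in> S" "last xs = x" "Linear ys \<in> S" "hd ys = y"
    using assms by (auto simp: valid_join_inputs_def b)
  have others: "(\<exists>xs. Linear xs \<in> S \<and> last xs = x') \<and> (\<exists>ys. Linear ys \<in> S \<and> hd ys = y') \<and>
      x' \<noteq> x \<and> y' \<noteq> y" if "(x', y') \<in> set B" for x' y'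
    using assms that unfolding valid_join_inputs_def b by auto
  have rest: "valid_join_inputs S' B"
    if "\<And>x' y'. (x', y') \<in> set B \<Longrightarrow>
      (\<exists>xs. Linear xs \<in> S' \<and> last xs = x') \<and> (\<exists>ys. Linear ys \<in> S' \<and> hd ys = y')" for S'
    using assms(2) that unfolding valid_join_inputs_def by (auto 0 3)
  show thesis
  proof (cases "xs = ys")
    case True
    have "valid_join_inputs (insert (Cyclic xs) (S - {Linear xs})) B"
      by (rule rest) (use others * True in blast)
    then show ?thesis using that join_sequences.close[of xs S x y] * True b by blast
  next
    case False
    have "valid_join_inputs (insert (Linear (xs @ ys)) (S - {Linear xs, Linear ys})) B"
    proof (rule rest)
      fix x' y' assume B: "(x', y') \<in> set B"
      obtain us vs where uv: "Linear us \<in> S" "last us = x'" "Linear vs \<in> S" "hd vs = y'"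
        using others[OF B] by blast
      have ne: "xs \<noteq> []" "ys \<noteq> []" using assms(1) * by (force simp: well_formed_def)+
      \<comment> \<open>But \<open>us = ys\<close> and \<open>vs = xs\<close> are possible; then
        \<open>xs @ ys\<close> inherits the end in question and is the witness.\<close>
      have "us \<noteq> xs" "vs \<noteq> ys" using others[OF B] uv * by auto
      then show "(\<exists>us. Linear us \<in> insert (Linear (xs @ ys)) (S - {Linear xs, Linear ys}) \<and> last us = x') \<and>
        (\<exists>vs. Linear vs \<in> insert (Linear (xs @ ys)) (S - {Linear xs, Linear ys}) \<and> hd vs = y')"
        using uv ne by (cases "us = ys"; cases "vs = xs") auto
    qed
    then show ?thesis using that join_sequences.concat[of xs S ys x y] * False b by blast
  qed
qed

section \<open>Searches\<close>

text \<open>Functionality and injectivity make the components of \<open>W\<close> paths and cycles.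
  The locale is used for the right links and for their converse, with \<open>U\<close> marking nodes
  that have a parent.\<close>

locale walks =
  fixes W :: "'p \<Rightarrow> 'p \<Rightarrow> bool" and U :: "'p \<Rightarrow> bool" and A :: "'p set"
  assumes fin: "finite A"
    and W_nodes: "W x y \<Longrightarrow> x \<in> A \<and> y \<in> A"
    and W_functional: "W x y \<Longrightarrow> W x z \<Longrightarrow> y = z"
    and W_injective: "W x z \<Longrightarrow> W y z \<Longrightarrow> x = y"
begin

text \<open>The guard is on the source of each step, so a walk can enter a node of \<open>U\<close>
  but never leave it.\<close>

definition walk :: "('p \<times> 'p) set" where
  "walk = {(x, y). W x y \<and> \<not> U x}"

text \<open>A search from \<open>v\<close> stops instead of returning to \<open>v\<close>.\<close>

definition tour :: "'p \<Rightarrow> ('p \<times> 'p) set" where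
  "tour v = {(x, y). W x y \<and> \<not> U x \<and> y \<noteq> v}"

text \<open>The number of nodes that a search from \<open>v\<close> standing at \<open>c\<close> may
  still visit, \<open>c\<close> included.\<close>

definition rank :: "'p \<Rightarrow> 'p \<Rightarrow> nat" where
  "rank v c = card ((tour v)\<^sup>* `` {c})"

lemma tour_walk: "(x, y) \<in> (tour v)\<^sup>* \<Longrightarrow> (x, y) \<in> walk\<^sup>*"
  by (rule subsetD[OF rtrancl_mono]) (auto simp: tour_def walk_def)

lemma walk_node: "(x, y) \<in> walk\<^sup>* \<Longrightarrow> x \<in> A \<Longrightarrow> y \<in> A"
  by (induction rule: rtrancl_induct) (auto simp: walk_def dest: W_nodes)

text \<open>Walks from \<open>v\<close> are deterministic, and none can get past \<open>p\<close>,
  because \<open>p\<close> lies in \<open>U\<close>.\<close>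

lemma walk_continue:
  assumes "(v, c) \<in> walk\<^sup>*" "(v, p) \<in> walk\<^sup>*" "U p"
  shows "(c, p) \<in> walk\<^sup>*"
  using assms(1)
proof (induction rule: rtrancl_induct)
  case (step c d)
  from step(3) show ?case
  proof (cases rule: converse_rtranclE)
    case base
    then show ?thesis using step(2) assms(3) by (simp add: walk_def)
  next
    case (step y)
    then show ?thesis using \<open>(c, d) \<in> walk\<close> W_functional by (auto simp: walk_def)
  qed
qed (use assms in simp)

lemma walk_end_unique:
  assumes "(v, a) \<in> walk\<^sup>*" "(v, b) \<in> walk\<^sup>*" "U a" "U b"
  shows "a = b"
  using walk_continue[OF assms(1,2,4)] assms(3)
  by (auto elim: converse_rtranclE simp: walk_def)

lemma walk_next:
  assumes "(v, c) \<in> walk\<^sup>*" "(v, p) \<in> walk\<^sup>*" "U p" "\<not> U c"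
  obtains d where "W c d" "(d, p) \<in> walk\<^sup>*"
  using walk_continue[OF assms(1-3)] assms(3,4)
  by (auto elim: converse_rtranclE simp: walk_def)

text \<open>A search stops at its origin only if its cycle has no parent at all. If \<open>c\<close>
  were followed by \<open>v\<close>, then \<open>p\<close> would lie on the way round to
  \<open>c\<close>; but a walk cannot leave \<open>p\<close>, so \<open>c = p\<close>, against
  \<open>\<not> U c\<close>.\<close>

lemma tour_no_return:
  assumes "(v, c) \<in> (tour v)\<^sup>*" "\<not> U c" "(v, p) \<in> walk\<^sup>*" "U p"
  shows "\<not> W c v"
proof
  assume cv: "W c v"
  \<comment> \<open>Every node on the walk from \<open>v\<close> to \<open>p\<close> can be
    continued to \<open>c\<close>: either it is not \<open>c\<close> and the tour goes on, or it is
    \<open>c\<close> and the next node is \<open>v\<close>, where the tour starts afresh.\<close>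
  have "(p, c) \<in> (tour v)\<^sup>*" using assms(3)
  proof (induction rule: rtrancl_induct)
    case (step x y)
    from step(3) show ?case
    proof (cases rule: converse_rtranclE)
      case base
      then have "y = v" using step(2) cv W_functional by (auto simp: walk_def)
      then show ?thesis using assms(1) by simp
    next
      case (step z)
      then show ?thesis using \<open>(x, y) \<in> walk\<close> W_functional by (auto simp: walk_def tour_def)
    qed
  qed (rule assms(1))
  then show False using assms(2,4) by (auto elim: converse_rtranclE simp: tour_def)
qed

text \<open>Reversal moves the guard from one end of each step to the other; hence
  \<open>\<not> U c\<close> is assumed and \<open>\<not> U v\<close> is gained.\<close>

lemma walk_reverse:
  assumes "(v, c) \<in> walk\<^sup>*" "\<not> U c"
  shows "(c, v) \<in> {(x, y). W y x \<and> \<not> U x}\<^sup>* \<and> \<not> U v"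
  using assms
proof (induction rule: rtrancl_induct)
  case (step c d)
  then have "(d, c) \<in> {(x, y). W y x \<and> \<not> U x}" by (auto simp: walk_def)
  then show ?case using step by (auto simp: walk_def intro: converse_rtrancl_into_rtrancl)
qed simp

text \<open>No step of \<open>tour v\<close> enters \<open>v\<close>, so \<open>v\<close> lies on no
  cycle. By injectivity a cycle through \<open>y\<close> also passes through its predecessor, which
  carries the claim along the tour.\<close>

lemma tour_acyclic: "(v, c) \<in> (tour v)\<^sup>* \<Longrightarrow> (c, c) \<notin> (tour v)\<^sup>+"
proof (induction rule: rtrancl_induct)
  case base
  then show ?case by (auto elim: tranclE simp: tour_def)
next
  case (step x y)
  show ?case
  proof
    assume "(y, y) \<in> (tour v)\<^sup>+"
    then obtain z where "(y, z) \<in> (tour v)\<^sup>*" "(z, y) \<in> tour v" by (meson tranclD2)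
    moreover then have "z = x" using step(2) W_injective by (auto simp: tour_def)
    ultimately show False using step(2,3) by (meson rtrancl_into_trancl2)
  qed
qed

lemma tour_image: "(tour v)\<^sup>* `` {c} \<subseteq> insert c A"
proof
  fix x assume "x \<in> (tour v)\<^sup>* `` {c}"
  then have "(c, x) \<in> (tour v)\<^sup>*" by simp
  then show "x \<in> insert c A" by (cases rule: rtranclE) (auto simp: tour_def dest: W_nodes)
qed

lemma finite_tour_image: "finite ((tour v)\<^sup>* `` {c})"
  using tour_image fin by (metis finite_insert finite_subset)

lemma rank_decreases:
  assumes "(v, c) \<in> (tour v)\<^sup>*" "(c, d) \<in> tour v"
  shows "rank v d < rank v c"
  unfolding rank_def
proof (intro psubset_card_mono finite_tour_image psubsetI)
  show "(tour v)\<^sup>* `` {d} \<subseteq> (tour v)\<^sup>* `` {c}"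
    using assms(2) by (auto intro: converse_rtrancl_into_rtrancl)
  have "(d, c) \<notin> (tour v)\<^sup>*" using tour_acyclic[OF assms(1)] assms(2) by (meson rtrancl_into_trancl2)
  then show "(tour v)\<^sup>* `` {d} \<noteq> (tour v)\<^sup>* `` {c}" by blast
qed

lemma rank_le: "c \<in> A \<Longrightarrow> rank v c \<le> card A"
  unfolding rank_def using tour_image[of v c] fin by (intro card_mono) (auto simp: insert_absorb)

lemma rank_pos: "0 < rank v c"
  unfolding rank_def using finite_tour_image[of v c] by (auto simp: card_gt_0_iff)

end

section \<open>Concurrent joins\<close>

text \<open>\<open>R0\<close> and \<open>R\<close> are the right links of the initial and of the final valid skip list.\<close>

locale concurrent_join =
  fixes R R0 :: "'p \<Rightarrow> 'p \<Rightarrow> bool" and A :: "'p set" and lev :: "'p \<Rightarrow> nat"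
    and m0 :: "'p heap" and cs0 :: "'p control list"
  assumes finite_nodes: "finite A"
    and R_nodes: "R p q \<Longrightarrow> p \<in> A \<and> q \<in> A"
    and R_lev: "R p q \<Longrightarrow> lev p = lev q"
    and R_functional: "R p q \<Longrightarrow> R p q' \<Longrightarrow> q = q'"
    and R_injective: "R p q \<Longrightarrow> R p' q \<Longrightarrow> p = p'"
    and R0_R: "R0 p q \<Longrightarrow> R p q"
    and linked: "horizontally_linked R0 A m0"
    and up_node: "p \<in> A \<Longrightarrow> ptr_up m0 p = Some p' \<Longrightarrow> p' \<in> A \<and> lev p' = Suc (lev p)"
    and up_exists: "p \<in> A \<Longrightarrow> lev p \<noteq> 1 \<Longrightarrow> \<exists>q\<in>A. ptr_up m0 q = Some p"
    and climb: "p \<in> A \<Longrightarrow> q \<in> A \<Longrightarrow> ptr_up m0 p = Some p' \<Longrightarrow> ptr_up m0 q = Some q' \<Longrightarrow>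
      R p' q' \<longleftrightarrow> skip R (\<lambda>x. ptr_up m0 x \<noteq> None) p q"
    and climb0: "p \<in> A \<Longrightarrow> q \<in> A \<Longrightarrow> ptr_up m0 p = Some p' \<Longrightarrow> ptr_up m0 q = Some q' \<Longrightarrow>
      skip R0 (\<lambda>x. ptr_up m0 x \<noteq> None) p q \<Longrightarrow> R0 p' q'"
    and start: "c \<in> set cs0 \<Longrightarrow> \<exists>p q. c = CasRight p q \<and> R p q"
    and start_new: "R p q \<Longrightarrow> lev p = 1 \<Longrightarrow> \<not> R0 p q \<Longrightarrow> CasRight p q \<in> set cs0"
begin

abbreviation up :: "'p \<Rightarrow> 'p option" where "up \<equiv> ptr_up m0"

definition U :: "'p \<Rightarrow> bool" where "U x \<longleftrightarrow> up x \<noteq> None"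

lemma U_eq: "(\<lambda>x. up x \<noteq> None) = U" by (auto simp: U_def)

lemma U_simps [simp]: "up x = Some y \<Longrightarrow> U x" "up x = None \<Longrightarrow> \<not> U x"
  by (auto simp: U_def)

lemmas climb_U = climb[unfolded U_eq] and climb0_U = climb0[unfolded U_eq]

sublocale right: walks R U A
  by unfold_locales (use finite_nodes R_nodes R_functional R_injective in blast)+

sublocale left: walks "\<lambda>x y. R y x" U A
  by unfold_locales (use finite_nodes R_nodes R_functional R_injective in blast)+

text \<open>\<open>a \<rightarrow> b\<close> is a link of the final list on the stretch from \<open>p\<close> to \<open>q\<close>, all of whose inner nodes are
  topmost nodes of their elements. The end points may coincide when the list is cyclic.\<close>

definition between :: "'p \<Rightarrow> 'p \<Rightarrow> 'p \<Rightarrow> 'p \<Rightarrow> bool" where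
  "between p q a b \<longleftrightarrow> R a b \<and> (a, p) \<in> left.walk\<^sup>* \<and> (b, q) \<in> right.walk\<^sup>*"

text \<open>The link from \<open>a\<close> to \<open>b\<close> is first extended forward to
  \<open>q\<close>, then backward to \<open>p\<close>; every node passed on the way lies outside
  \<open>U\<close>.\<close>

lemma skip_if_between:
  assumes "between p q a b" "U q"
  shows "skip R U p q"
proof -
  have ab: "R a b" and ap: "(a, p) \<in> left.walk\<^sup>*" and bq: "(b, q) \<in> right.walk\<^sup>*"
    using assms(1) by (auto simp: between_def)
  have "skip R U a q" using bq ab
  proof (induction arbitrary: a rule: converse_rtrancl_induct)
    case base
    then show ?case using assms(2) by (auto intro: skip.hit)
  next
    case (step x y)
    then show ?case by (intro skip.pass[of R a x]) (auto simp: right.walk_def)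
  qed
  with ap show ?thesis
  proof (induction rule: rtrancl_induct)
    case (step x y)
    then show ?case by (intro skip.pass[of R y x]) (auto simp: left.walk_def)
  qed
qed

text \<open>The core of safety: parents found on the two sides of one link of \<open>R\<close> are
  themselves linked by \<open>R\<close>.\<close>

lemma climb_between:
  assumes "between p q a b" "up p = Some p'" "up q = Some q'"
  shows "R p' q'"
proof -
  have "p \<in> A" "q \<in> A" using assms(1) left.walk_node right.walk_node R_nodes
    unfolding between_def by blast+
  then show ?thesis using climb_U skip_if_between[OF assms(1)] assms by auto
qed

text \<open>For the initial state: a stretch made only of old links is already a stretch of the old
  list. Links after \<open>c\<close> still lie between \<open>a\<close> and \<open>b\<close>,
  because the left walk may pass through \<open>c\<close>.\<close>

lemma skip_R0_if_between_R0:
  assumes "skip R U p q" "\<And>a b. between p q a b \<Longrightarrow> R0 a b"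
  shows "skip R0 U p q"
  using assms
proof (induction rule: skip.induct)
  case (hit a b)
  then show ?case by (auto simp: between_def intro: skip.hit)
next
  case (pass a c b)
  obtain d where d: "R c d" "(d, b) \<in> right.walk\<^sup>*"
  proof -
    from pass(3) have "\<exists>d. R c d \<and> (d, b) \<in> right.walk\<^sup>*"
      by (induction rule: skip.induct)
        (auto simp: right.walk_def intro: converse_rtrancl_into_rtrancl)
    then show ?thesis using that by blast
  qed
  have "(c, b) \<in> right.walk\<^sup>*"
    using d pass(2) by (auto simp: right.walk_def intro: converse_rtrancl_into_rtrancl)
  then have "between a b a c" using pass(1) by (auto simp: between_def)
  then have "R0 a c" by (rule pass.prems)
  moreover have "between a b x y" if "between c b x y" for x y
    using that pass(1,2) by (auto simp: between_def left.walk_def intro: rtrancl_into_rtrancl)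
  ultimately show ?case using pass by (blast intro: skip.pass)
qed

section \<open>Safety invariants of the heap and of a single thread\<close>

definition found :: "'p \<Rightarrow> 'p option \<Rightarrow> bool" where
  "found p u \<longleftrightarrow> (\<forall>p'. u = Some p' \<longrightarrow> (\<exists>a. (p, a) \<in> left.walk\<^sup>* \<and> up a = Some p'))"

text \<open>A failed search, \<open>None\<close>, is always acceptable here; success is the business
  of \<open>serves\<close>. Positions are recorded with \<open>tour\<close> instead of
  \<open>walk\<close>, since termination and \<open>tour_no_return\<close> rely on the origin not
  being revisited.\<close>

fun thread_ok :: "'p heap \<Rightarrow> 'p control \<Rightarrow> bool" where
  "thread_ok m (CasRight p q) \<longleftrightarrow> R p q"
| "thread_ok m (SetLeft p q) \<longleftrightarrow> R p q \<and> ptr_right m p = Some q"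
| "thread_ok m (TestUpL p q c) \<longleftrightarrow> R p q \<and> (p, c) \<in> (left.tour p)\<^sup>*"
| "thread_ok m (MoveLeft p q c) \<longleftrightarrow> R p q \<and> (p, c) \<in> (left.tour p)\<^sup>* \<and> \<not> U c"
| "thread_ok m (RetUpL p q c) \<longleftrightarrow> R p q \<and> (p, c) \<in> (left.tour p)\<^sup>* \<and> U c"
| "thread_ok m (TestUpR p q u c) \<longleftrightarrow> R p q \<and> found p u \<and> (q, c) \<in> (right.tour q)\<^sup>*"
| "thread_ok m (MoveRight p q u c) \<longleftrightarrow> R p q \<and> found p u \<and> (q, c) \<in> (right.tour q)\<^sup>* \<and> \<not> U c"
| "thread_ok m (RetUpR p q u c) \<longleftrightarrow> R p q \<and> found p u \<and> (q, c) \<in> (right.tour q)\<^sup>* \<and> U c"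
| "thread_ok m Done \<longleftrightarrow> True"

text \<open>The last conjunct orders the two halves of a link: a left pointer appears only when the
  matching right pointer is already set.\<close>

definition heap_ok :: "'p heap \<Rightarrow> bool" where
  "heap_ok m \<longleftrightarrow> ptr_up m = ptr_up m0 \<and> ptr_down m = ptr_down m0 \<and>
    (\<forall>p. p \<notin> A \<longrightarrow> ptr_right m p = ptr_right m0 p \<and> ptr_left m p = ptr_left m0 p) \<and>
    (\<forall>p q. R0 p q \<longrightarrow> ptr_right m p = Some q \<and> ptr_left m q = Some p) \<and>
    (\<forall>p\<in>A. \<forall>q. ptr_right m p = Some q \<longrightarrow> R p q) \<and>
    (\<forall>q\<in>A. \<forall>p. ptr_left m q = Some p \<longrightarrow> R p q \<and> ptr_right m p = Some q)"

lemma heap_okD: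
  assumes "heap_ok m"
  shows "ptr_up m = ptr_up m0" "ptr_down m = ptr_down m0"
    "p \<notin> A \<Longrightarrow> ptr_right m p = ptr_right m0 p" "p \<notin> A \<Longrightarrow> ptr_left m p = ptr_left m0 p"
    "R0 p q \<Longrightarrow> ptr_right m p = Some q" "R0 p q \<Longrightarrow> ptr_left m q = Some p"
    "p \<in> A \<Longrightarrow> ptr_right m p = Some q \<Longrightarrow> R p q"
    "q \<in> A \<Longrightarrow> ptr_left m q = Some p \<Longrightarrow> R p q"
    "q \<in> A \<Longrightarrow> ptr_left m q = Some p \<Longrightarrow> ptr_right m p = Some q"
  using assms unfolding heap_ok_def by blast+

text \<open>The compare-and-swap overwrites only null. A write to the left pointer of
  \<open>q\<close> comes from a thread whose pair is in \<open>R\<close>, so by injectivity it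
  writes the value \<open>p\<close> again.\<close>

lemma exec_grows:
  assumes "exec c m = (c', m')" "heap_ok m" "thread_ok m c"
  shows "ptr_right m p = Some q \<Longrightarrow> ptr_right m' p = Some q"
    and "R p q \<Longrightarrow> ptr_left m q = Some p \<Longrightarrow> ptr_left m' q = Some p"
  using assms R_injective by (cases c; auto split: if_splits)+

lemma exec_heap_ok:
  assumes "exec c m = (c', m')" "heap_ok m" "thread_ok m c"
  shows "heap_ok m'"
proof (cases "m' = m")
  case False
  then consider p q where "c = CasRight p q" "ptr_right m p = None"
      "m' = m\<lparr>ptr_right := (ptr_right m)(p := Some q)\<rparr>"
    | p q where "c = SetLeft p q" "m' = m\<lparr>ptr_left := (ptr_left m)(q := Some p)\<rparr>"
    using assms(1) by (cases c) (auto split: if_splits)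
  then show ?thesis
  proof cases
    case (1 p q)
    have "R p q" using assms(3) 1 by simp
    moreover have "p \<noteq> p'" if "R0 p' q'" for p' q'
      using heap_okD(5)[OF assms(2) that] 1 by auto
    ultimately show ?thesis
      using heap_okD[OF assms(2)] R_nodes[of p q] 1 unfolding heap_ok_def
      by (simp (no_asm_simp)) (metis option.distinct(1))
  next
    case (2 p q)
    have "R p q" "ptr_right m p = Some q" using assms(3) 2 by simp_all
    moreover have "p' = p" if "R0 p' q" for p'
      using R0_R[OF that] \<open>R p q\<close> by (rule R_injective)
    ultimately show ?thesis
      using heap_okD[OF assms(2)] R_nodes[of p q] 2 unfolding heap_ok_def
      by (simp (no_asm_simp))
  qed
qed (use assms in simp)

lemma exec_other_ok:
  assumes "exec c m = (c', m')" "heap_ok m" "thread_ok m c" "thread_ok m d"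
  shows "thread_ok m' d"
  using assms(4) exec_grows[OF assms(1-3)] by (cases d) auto

lemma after_search_cases:
  "(\<exists>p q. u = Some p \<and> v = Some q \<and> after_search u v = CasRight p q) \<or>
   ((u = None \<or> v = None) \<and> after_search u v = Done)"
  by (cases u; cases v) auto

lemma exec_thread_ok:
  assumes "exec c m = (c', m')" "heap_ok m" "thread_ok m c"
  shows "thread_ok m' c'"
proof (cases c)
  case (MoveLeft p q c0)
  then have ok: "R p q" "(p, c0) \<in> (left.tour p)\<^sup>*" "\<not> U c0" using assms(3) by auto
  then have "c0 \<in> A" using left.tour_walk left.walk_node R_nodes by blast
  \<comment> \<open>A non-null pointer agrees with \<open>R\<close>, and the test against the origin
    is exactly the guard of \<open>tour\<close>.\<close>
  then have "(c0, d) \<in> left.tour p" if "ptr_left m c0 = Some d" "d \<noteq> p" for d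
    using that ok heap_okD(8)[OF assms(2)] by (auto simp: left.tour_def)
  then have "(p, d) \<in> (left.tour p)\<^sup>*" if "ptr_left m c0 = Some d" "d \<noteq> p" for d
    using that by (blast intro: rtrancl_into_rtrancl[OF ok(2)])
  then show ?thesis using assms(1) ok MoveLeft
    by (auto split: option.splits if_splits simp: found_def)
next
  case (MoveRight p q u c0)
  then have ok: "R p q" "(q, c0) \<in> (right.tour q)\<^sup>*" "\<not> U c0" "found p u" using assms(3) by auto
  then have "c0 \<in> A" using right.tour_walk right.walk_node R_nodes by blast
  then have "(c0, d) \<in> right.tour q" if "ptr_right m c0 = Some d" "d \<noteq> q" for d
    using that ok heap_okD(7)[OF assms(2)] by (auto simp: right.tour_def)
  then have "(q, d) \<in> (right.tour q)\<^sup>*" if "ptr_right m c0 = Some d" "d \<noteq> q" for d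
    using that by (blast intro: rtrancl_into_rtrancl[OF ok(2)])
  then show ?thesis using assms(1) ok MoveRight
    using after_search_cases[of u None] by (auto split: option.splits if_splits)
next
  case (RetUpL p q c0)
  then have "(p, c0) \<in> left.walk\<^sup>*" using assms(3) left.tour_walk by auto
  then show ?thesis using assms heap_okD(1)[OF assms(2)] RetUpL by (auto simp: found_def)
next
  case (RetUpR p q u c0)
  then have ok: "R p q" "(q, c0) \<in> right.walk\<^sup>*" "found p u"
    using assms(3) right.tour_walk by auto
  have "R p' q'" if u: "u = Some p'" "up c0 = Some q'" for p' q'
  proof -
    obtain a where "(p, a) \<in> left.walk\<^sup>*" "up a = Some p'" using ok(3) u by (auto simp: found_def)
    then show ?thesis using climb_between[of a c0 p q] ok u by (auto simp: between_def)
  qed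
  then show ?thesis using after_search_cases[of u "up c0"] assms(1) heap_okD(1)[OF assms(2)] RetUpR
    by auto
qed (use assms heap_okD(1)[OF assms(2)] in \<open>auto split: if_splits\<close>)

text \<open>A thread that can still be relied upon to link the parents of \<open>p\<close> and \<open>q\<close> once the stretch between
  them is complete. A thread whose left search already failed is not one, which is why the result
  of that search occurs in the last three search states.\<close>

fun serves :: "'p \<Rightarrow> 'p \<Rightarrow> 'p control \<Rightarrow> bool" where
  "serves p q (CasRight a b) \<longleftrightarrow> up p = Some a \<and> up q = Some b"
| "serves p q (TestUpL a b c) \<longleftrightarrow> between p q a b"
| "serves p q (MoveLeft a b c) \<longleftrightarrow> between p q a b"
| "serves p q (RetUpL a b c) \<longleftrightarrow> between p q a b"
| "serves p q (TestUpR a b u c) \<longleftrightarrow> between p q a b \<and> u = up p"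
| "serves p q (MoveRight a b u c) \<longleftrightarrow> between p q a b \<and> u = up p"
| "serves p q (RetUpR a b u c) \<longleftrightarrow> between p q a b \<and> u = up p"
| "serves p q _ \<longleftrightarrow> False"

text \<open>Left pointers alone are mentioned because they are written last; the right pointers then
  follow from \<open>heap_ok\<close>.\<close>

definition complete :: "'p heap \<Rightarrow> 'p \<Rightarrow> 'p \<Rightarrow> bool" where
  "complete m p q \<longleftrightarrow> (\<forall>a b. between p q a b \<longrightarrow> ptr_left m b = Some a)"

text \<open>On a complete stretch neither search can meet null or return to its origin, so they end
  at \<open>p\<close> and \<open>q\<close>. The final compare-and-swap succeeds or finds a pointer
  that by functionality of \<open>R\<close> is already the right one.\<close>

lemma exec_serves:
  assumes "exec c m = (c', m')" "heap_ok m" "thread_ok m c"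
    and "serves p q c" "complete m p q" "up p = Some p'" "up q = Some q'" "R p' q'"
  shows "ptr_right m' p' = Some q' \<or> serves p q c'"
proof (cases c)
  case (CasRight a b)
  then have c: "c = CasRight p' q'" using assms(4,6,7) by simp
  show ?thesis
  proof (cases "ptr_right m p'")
    case None
    then show ?thesis using assms(1) c by auto
  next
    case (Some r)
    then have "r = q'" using assms(8) R_nodes R_functional heap_okD(7)[OF assms(2)] by blast
    then show ?thesis using Some exec_grows[OF assms(1-3)] by blast
  qed
next
  case (MoveLeft a b c0)
  then have btw: "between p q a b" and t: "(a, c0) \<in> (left.tour a)\<^sup>*" and n: "\<not> U c0"
    using assms(3,4) by auto
  then have ab: "R a b" and ap: "(a, p) \<in> left.walk\<^sup>*" and bq: "(b, q) \<in> right.walk\<^sup>*"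
    by (auto simp: between_def)
  obtain d where d: "R d c0" "(d, p) \<in> left.walk\<^sup>*"
    using left.walk_next[OF left.tour_walk[OF t] ap] n assms(6) by auto
  \<comment> \<open>Turned round, the left walk to \<open>c0\<close> becomes a right walk through
    the link from \<open>a\<close> to \<open>b\<close> on to \<open>q\<close>. Hence the link
    entering \<open>c0\<close> lies on the stretch and completeness applies to it.\<close>
  have rev: "(c0, a) \<in> right.walk\<^sup>*" "\<not> U a"
    using left.walk_reverse[OF left.tour_walk[OF t] n] by (auto simp: right.walk_def)
  then have "(c0, q) \<in> right.walk\<^sup>*"
    using ab bq by (auto simp: right.walk_def intro: converse_rtrancl_into_rtrancl rtrancl_trans)
  then have "ptr_left m c0 = Some d" using d assms(5) by (auto simp: complete_def between_def)
  moreover have "d \<noteq> a" using left.tour_no_return[OF t n ap] d(1) assms(6) by auto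
  ultimately show ?thesis using assms(1) MoveLeft btw by auto
next
  case (RetUpL a b c0)
  then have btw: "between p q a b" and t: "(a, c0) \<in> left.walk\<^sup>*" and n: "U c0"
    using assms(3,4) left.tour_walk by auto
  have "c0 = p" using left.walk_end_unique[OF t _ n] btw assms(6) by (auto simp: between_def)
  then show ?thesis using assms(1) RetUpL btw heap_okD(1)[OF assms(2)] by auto
next
  case (MoveRight a b u c0)
  then have btw: "between p q a b" "u = up p" and t: "(b, c0) \<in> (right.tour b)\<^sup>*" and n: "\<not> U c0"
    using assms(3,4) by auto
  then have ab: "R a b" and ap: "(a, p) \<in> left.walk\<^sup>*" and bq: "(b, q) \<in> right.walk\<^sup>*"
    by (auto simp: between_def)
  obtain d where d: "R c0 d" "(d, q) \<in> right.walk\<^sup>*"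
    using right.walk_next[OF right.tour_walk[OF t] bq] n assms(7) by auto
  have rev: "(c0, b) \<in> left.walk\<^sup>*" "\<not> U b"
    using right.walk_reverse[OF right.tour_walk[OF t] n] by (auto simp: left.walk_def)
  then have "(c0, p) \<in> left.walk\<^sup>*"
    using ab ap by (auto simp: left.walk_def intro: converse_rtrancl_into_rtrancl rtrancl_trans)
  then have "ptr_left m d = Some c0" using d assms(5) by (auto simp: complete_def between_def)
  then have "ptr_right m c0 = Some d" using heap_okD(9)[OF assms(2)] d R_nodes by blast
  moreover have "d \<noteq> b" using right.tour_no_return[OF t n bq] d(1) assms(7) by auto
  ultimately show ?thesis using assms(1) MoveRight btw by auto
next
  case (RetUpR a b u c0)
  then have btw: "between p q a b" "u = up p" and t: "(b, c0) \<in> right.walk\<^sup>*" and n: "U c0"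
    using assms(3,4) right.tour_walk by auto
  have "c0 = q" using right.walk_end_unique[OF t _ n] btw assms(7) by (auto simp: between_def)
  then show ?thesis using assms(1,6,7) RetUpR btw heap_okD(1)[OF assms(2)] by auto
qed (use assms in \<open>auto split: if_splits\<close>)

text \<open>The last thread to complete a stretch starts its searches only afterwards, so it serves it.\<close>

lemma exec_completes:
  assumes "exec c m = (c', m')" "complete m' p q" "\<not> complete m p q"
  shows "serves p q c'"
proof -
  obtain a b where *: "between p q a b" "ptr_left m b \<noteq> Some a" "ptr_left m' b = Some a"
    using assms(2,3) unfolding complete_def by blast
  then have "c = SetLeft a b" using assms(1) by (cases c) (auto split: if_splits)
  then show ?thesis using assms(1) * by auto
qed

text \<open>After safety come three debts, each paid or owed by some thread: the left half of a
  link, a missing link on level 1, and the link above a complete stretch. With every thread at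
  \<open>Done\<close> nothing can be owed.\<close>

definition inv :: "'p heap \<times> 'p control list \<Rightarrow> bool" where
  "inv = (\<lambda>(m, cs). heap_ok m \<and> (\<forall>c\<in>set cs. thread_ok m c) \<and>
    (\<forall>p q. R p q \<and> ptr_right m p = Some q \<longrightarrow> ptr_left m q = Some p \<or> SetLeft p q \<in> set cs) \<and>
    (\<forall>p q. R p q \<and> lev p = 1 \<longrightarrow> ptr_right m p = Some q \<or> CasRight p q \<in> set cs) \<and>
    (\<forall>p q p' q'. p \<in> A \<and> q \<in> A \<and> up p = Some p' \<and> up q = Some q' \<and> R p' q' \<and> complete m p q \<longrightarrow>
      ptr_right m p' = Some q' \<or> (\<exists>c\<in>set cs. serves p q c)))"

lemma inv_initial: "inv (m0, cs0)"
proof -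
  have m0: "p \<in> A \<Longrightarrow> ptr_right m0 p = Some q \<longleftrightarrow> R0 p q"
    "q \<in> A \<Longrightarrow> ptr_left m0 q = Some p \<longleftrightarrow> R0 p q" for p q
    using linked by (auto simp: horizontally_linked_def)
  have R0: "R0 p q \<Longrightarrow> p \<in> A \<and> q \<in> A" for p q using R0_R R_nodes by blast
  have "heap_ok m0" unfolding heap_ok_def using m0 R0 R0_R by auto
  moreover have "\<forall>c\<in>set cs0. thread_ok m0 c" using start by fastforce
  moreover have "ptr_left m0 q = Some p" if "R p q" "ptr_right m0 p = Some q" for p q
    using that m0 R_nodes by blast
  moreover have "ptr_right m0 p = Some q \<or> CasRight p q \<in> set cs0" if "R p q" "lev p = 1" for p q
    using start_new[OF that] m0(1) R_nodes that by blast
  moreover have "ptr_right m0 p' = Some q'"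
    if "p \<in> A" "q \<in> A" "up p = Some p'" "up q = Some q'" "R p' q'" "complete m0 p q" for p q p' q'
  proof -
    \<comment> \<open>Initially the left pointers are those of \<open>R0\<close>, so a complete
      stretch consists of old links and the link above it is old too.\<close>
    have "R0 a b" if "between p q a b" for a b
      using \<open>complete m0 p q\<close> that m0 R_nodes unfolding complete_def between_def by blast
    then have "skip R0 U p q" using skip_R0_if_between_R0 climb_U that by blast
    then have "R0 p' q'" using climb0_U that by blast
    then show ?thesis using m0 R0 by blast
  qed
  ultimately show ?thesis unfolding inv_def by blast
qed

lemma inv_step:
  assumes "inv s" "step s t"
  shows "inv t"
  using assms(2)
proof cases
  case (1 k cs m c' m')
  let ?cs' = "cs[k := c']"
  have ok: "heap_ok m" "thread_ok m (cs ! k)" and oks: "\<And>c. c \<in> set cs \<Longrightarrow> thread_ok m c"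
    using assms(1) 1 by (auto simp: inv_def)
  note ex = 1(5) ok
  have mem: "c' \<in> set ?cs'" using 1(3) by (rule set_update_memI)
  \<comment> \<open>Only the thread that moves can disappear from the set of control states.\<close>
  have keep: "c \<in> set ?cs' \<or> c = cs ! k" if "c \<in> set cs" for c
    using that by (metis in_set_conv_nth length_list_update nth_list_update_neq)
  have inv3: "ptr_left m q = Some p \<or> SetLeft p q \<in> set cs" if "R p q" "ptr_right m p = Some q" for p q
    using assms(1) that 1 by (auto simp: inv_def)
  have inv4: "ptr_right m p = Some q \<or> CasRight p q \<in> set cs" if "R p q" "lev p = 1" for p q
    using assms(1) that 1 by (auto simp: inv_def)
  have inv5: "ptr_right m p' = Some q' \<or> (\<exists>c\<in>set cs. serves p q c)"
    if "p \<in> A" "q \<in> A" "up p = Some p'" "up q = Some q'" "R p' q'" "complete m p q" for p q p' q'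
    using assms(1) that 1 by (auto simp: inv_def)
  have "heap_ok m'" using ex by (rule exec_heap_ok)
  moreover have "\<forall>c\<in>set ?cs'. thread_ok m' c"
    using exec_thread_ok[OF ex] exec_other_ok[OF ex] oks set_update_subset_insert[of cs k c'] by blast
  moreover have "ptr_left m' q = Some p \<or> SetLeft p q \<in> set ?cs'"
    if pq: "R p q" "ptr_right m' p = Some q" for p q
  proof (cases "ptr_right m p = Some q")
    case True
    then consider "ptr_left m q = Some p" | "SetLeft p q \<in> set ?cs'" | "SetLeft p q = cs ! k"
      using inv3[OF pq(1)] keep by blast
    then show ?thesis
    proof cases
      case 3
      then show ?thesis using ex(1) by (auto simp flip: 3)
    qed (use exec_grows[OF ex] pq in auto)
  next
    case False
    then have "c' = SetLeft p q" using ex(1) pq(2) by (cases "cs ! k") (auto split: if_splits)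
    then show ?thesis using mem by blast
  qed
  moreover have "ptr_right m' p = Some q \<or> CasRight p q \<in> set ?cs'"
    if pq: "R p q" "lev p = 1" for p q
  proof -
    consider "ptr_right m p = Some q" | "CasRight p q \<in> set ?cs'" | "CasRight p q = cs ! k"
      using inv4[OF pq] keep by blast
    then show ?thesis
    proof cases
      case 3
      show ?thesis
      proof (cases "ptr_right m p")
        case None
        then show ?thesis using ex(1) by (auto simp flip: 3)
      next
        case (Some r)
        then have "r = q" using pq R_nodes R_functional heap_okD(7)[OF ok(1)] by blast
        then show ?thesis using Some exec_grows[OF ex] by blast
      qed
    qed (use exec_grows[OF ex] in auto)
  qed
  moreover have "ptr_right m' p' = Some q' \<or> (\<exists>c\<in>set ?cs'. serves p q c)"
    if pq: "p \<in> A" "q \<in> A" "up p = Some p'" "up q = Some q'" "R p' q'" "complete m' p q" for p q p' q'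
  proof (cases "complete m p q")
    case True
    then consider "ptr_right m p' = Some q'" | c where "c \<in> set ?cs'" "serves p q c"
      | "serves p q (cs ! k)"
      using inv5[OF pq(1-5)] keep by blast
    then show ?thesis
    proof cases
      case 3
      then show ?thesis using exec_serves[OF ex 3 True pq(3-5)] mem by blast
    qed (use exec_grows[OF ex] in auto)
  next
    case False
    then show ?thesis using exec_completes[OF ex(1) pq(6)] mem by blast
  qed
  ultimately show ?thesis unfolding inv_def 1(2) by blast
qed

lemma inv_reachable: "step\<^sup>*\<^sup>* (m0, cs0) s \<Longrightarrow> inv s"
  by (induction rule: rtranclp_induct) (auto intro: inv_initial inv_step)

section \<open>Terminal states\<close>

lemma stuck_Done:
  assumes "\<nexists>d. step (m, cs) d"
  shows "\<forall>c\<in>set cs. c = Done"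
proof (rule ballI, rule ccontr)
  fix c assume "c \<in> set cs" "c \<noteq> Done"
  then obtain k where k: "k < length cs" "cs ! k \<noteq> Done" by (auto simp: in_set_conv_nth)
  obtain c' m' where "exec (cs ! k) m = (c', m')" by fastforce
  then show False using step.intros[OF k] assms by blast
qed

text \<open>By induction the level below is fully linked, so the stretch under \<open>p\<close> and
  \<open>q\<close> is complete. No thread is left to owe the right pointer above it, and then none
  to owe the left pointer.\<close>

lemma final_left:
  assumes "inv (m, cs)" "\<forall>c\<in>set cs. c = Done" "R p q"
  shows "ptr_left m q = Some p"
  using assms(3)
proof (induction "lev p" arbitrary: p q rule: less_induct)
  case less
  have "ptr_right m p = Some q"
  proof (cases "lev p = 1")
    case True
    then have "ptr_right m p = Some q \<or> CasRight p q \<in> set cs"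
      using assms(1) less(2) unfolding inv_def by blast
    then show ?thesis using assms(2) by blast
  next
    case False
    have nodes: "p \<in> A" "q \<in> A" "lev q \<noteq> 1" using R_nodes R_lev less(2) False by auto
    obtain a b where ab: "a \<in> A" "up a = Some p" "b \<in> A" "up b = Some q"
      using up_exists nodes False by meson
    have "complete m a b"
      unfolding complete_def
    proof (intro allI impI)
      fix x y assume "between a b x y"
      then have xy: "R x y" "(x, a) \<in> left.walk\<^sup>*" by (auto simp: between_def)
      from xy(2) have "lev x = lev a"
        by (induction rule: rtrancl_induct) (auto simp: left.walk_def dest: R_lev)
      then have "lev x < lev p" using up_node ab by fastforce
      then show "ptr_left m y = Some x" using less(1) xy(1) by blast
    qed
    then have "ptr_right m p = Some q \<or> (\<exists>c\<in>set cs. serves a b c)"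
      using assms(1) ab less(2) unfolding inv_def by blast
    then show ?thesis using assms(2) by auto
  qed
  then have "ptr_left m q = Some p \<or> SetLeft p q \<in> set cs"
    using assms(1) less(2) unfolding inv_def by blast
  then show ?case using assms(2) by blast
qed

theorem terminal_state:
  assumes "step\<^sup>*\<^sup>* (m0, cs0) (m, cs)" "\<nexists>d. step (m, cs) d"
  shows "\<forall>c\<in>set cs. c = Done" "horizontally_linked R A m"
    "ptr_up m = ptr_up m0" "ptr_down m = ptr_down m0"
    "\<forall>p. p \<notin> A \<longrightarrow> ptr_right m p = ptr_right m0 p \<and> ptr_left m p = ptr_left m0 p"
proof -
  have inv: "inv (m, cs)" using assms(1) by (rule inv_reachable)
  show fin: "\<forall>c\<in>set cs. c = Done" using assms(2) by (rule stuck_Done)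
  have ok: "heap_ok m" using inv by (simp add: inv_def)
  show "horizontally_linked R A m"
    unfolding horizontally_linked_def
    using heap_okD(7-9)[OF ok] final_left[OF inv fin] R_nodes by blast
  show "ptr_up m = ptr_up m0" "ptr_down m = ptr_down m0"
    "\<forall>p. p \<notin> A \<longrightarrow> ptr_right m p = ptr_right m0 p \<and> ptr_left m p = ptr_left m0 p"
    using heap_okD(1-4)[OF ok] by blast+
qed

section \<open>Termination\<close>

definition rounds :: "'p \<Rightarrow> nat" where
  "rounds p = (Max (lev ` A) - lev p) * (4 * card A + 5)"

text \<open>A search spends at most two instructions per node and visits at most
  \<open>card A\<close> nodes, so one call costs at most \<open>4 * card A + 5\<close> before it
  recurses. \<open>rounds\<close> reserves that amount for each level above, and the left search
  keeps \<open>2 * card A\<close> for the right one.\<close>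

fun work :: "'p control \<Rightarrow> nat" where
  "work (CasRight p q) = rounds p + 4 * card A + 5"
| "work (SetLeft p q) = rounds p + 4 * card A + 4"
| "work (TestUpL p q c) = rounds p + 2 * card A + 3 + 2 * left.rank p c"
| "work (MoveLeft p q c) = rounds p + 2 * card A + 2 + 2 * left.rank p c"
| "work (RetUpL p q c) = rounds p + 2 * card A + 2"
| "work (TestUpR p q u c) = rounds p + 1 + 2 * right.rank q c"
| "work (MoveRight p q u c) = rounds p + 2 * right.rank q c"
| "work (RetUpR p q u c) = rounds p + 1"
| "work Done = 0"

lemma rounds_up:
  assumes "p \<in> A" "p' \<in> A" "lev p' = Suc (lev p)"
  shows "rounds p' + (4 * card A + 5) = rounds p"
proof -
  have "Suc (lev p) \<le> Max (lev ` A)" using finite_nodes assms(2) by (auto simp flip: assms(3))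
  then have "Max (lev ` A) - lev p = Suc (Max (lev ` A) - lev p')" using assms(3) by simp
  then show ?thesis unfolding rounds_def by simp
qed

lemma exec_work:
  assumes "exec c m = (c', m')" "heap_ok m" "thread_ok m c" "c \<noteq> Done"
  shows "work c' < work c"
proof (cases c)
  case (SetLeft p q)
  then show ?thesis using assms left.rank_le[of p p] R_nodes by auto
next
  case (TestUpL p q c0)
  then show ?thesis using assms left.rank_pos[of p c0] by (auto split: if_splits)
next
  case (MoveLeft p q c0)
  then have ok: "R p q" "(p, c0) \<in> (left.tour p)\<^sup>*" "\<not> U c0" using assms(3) by auto
  then have c0: "c0 \<in> A" using left.tour_walk left.walk_node R_nodes by blast
  have "left.rank p d < left.rank p c0" if "ptr_left m c0 = Some d" "d \<noteq> p" for d
    using left.rank_decreases[OF ok(2)] heap_okD(8)[OF assms(2) c0 that(1)] that(2) ok(3)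
    by (auto simp: left.tour_def)
  then show ?thesis using assms(1) MoveLeft right.rank_le[of q q] R_nodes[OF ok(1)]
      left.rank_pos[of p c0]
    by (fastforce split: option.splits if_splits)
next
  case (RetUpL p q c0)
  then show ?thesis using assms right.rank_le[of q q] R_nodes[of p q] by auto
next
  case (TestUpR p q u c0)
  then show ?thesis using assms right.rank_pos[of q c0] by (auto split: if_splits)
next
  case (MoveRight p q u c0)
  then have ok: "R p q" "(q, c0) \<in> (right.tour q)\<^sup>*" "\<not> U c0" using assms(3) by auto
  then have c0: "c0 \<in> A" using right.tour_walk right.walk_node R_nodes by blast
  have "right.rank q d < right.rank q c0" if "ptr_right m c0 = Some d" "d \<noteq> q" for d
    using right.rank_decreases[OF ok(2)] heap_okD(7)[OF assms(2) c0 that(1)] that(2) ok(3)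
    by (auto simp: right.tour_def)
  then show ?thesis using assms(1) MoveRight right.rank_pos[of q c0] after_search_cases[of u None]
    by (fastforce split: option.splits if_splits)
next
  case (RetUpR p q u c0)
  then have ok: "R p q" "found p u" using assms(3) by auto
  \<comment> \<open>The left walk stays on the level of \<open>p\<close>, so \<open>p'\<close> is
    one level higher and a full round is released for the recursive call.\<close>
  have "rounds p' + (4 * card A + 5) = rounds p" if u: "u = Some p'" for p'
  proof -
    obtain a where a: "(p, a) \<in> left.walk\<^sup>*" "up a = Some p'" using ok(2) u by (auto simp: found_def)
    from a(1) have "lev p = lev a"
      by (induction rule: rtrancl_induct) (auto simp: left.walk_def dest: R_lev)
    moreover have "a \<in> A" using left.walk_node[OF a(1)] R_nodes[OF ok(1)] by blast
    ultimately show ?thesis using rounds_up[of p p'] up_node[OF _ a(2)] R_nodes[OF ok(1)] by auto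
  qed
  then show ?thesis using assms(1) RetUpR after_search_cases[of u "ptr_up m c0"] by auto
qed (use assms in \<open>auto split: if_splits\<close>)

lemma step_work:
  assumes "inv s" "step s t"
  shows "sum_list (map work (snd t)) < sum_list (map work (snd s))"
  using assms(2)
proof cases
  case (1 k cs m c' m')
  have "work c' < work (cs ! k)"
    using exec_work[OF 1(5)] assms(1) 1 by (auto simp: inv_def)
  moreover have "map work (cs[k := c']) = (map work cs)[k := work c']" by (rule map_update)
  moreover have "work (cs ! k) \<le> sum_list (map work cs)"
    using 1(3) by (auto intro!: member_le_sum_list)
  ultimately show ?thesis using 1 by (auto simp: sum_list_update)
qed

theorem no_infinite_run:
  "\<nexists>run. run 0 = (m0, cs0) \<and> (\<forall>n::nat. step (run n) (run (Suc n)))"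
proof
  assume "\<exists>run. run 0 = (m0, cs0) \<and> (\<forall>n::nat. step (run n) (run (Suc n)))"
  then obtain run where run: "run 0 = (m0, cs0)" "\<And>n::nat. step (run n) (run (Suc n))" by blast
  have "inv (run n)" for n
    by (induction n) (use run inv_initial inv_step in auto)
  then have "\<forall>n. (run (Suc n), run n) \<in> measure (\<lambda>s. sum_list (map work (snd s)))"
    using step_work run(2) by simp
  then show False using wf_measure wf_iff_no_infinite_down_chain by blast
qed

end

section \<open>Concurrent joins in a skip list\<close>

definition agree_outside :: "'p set \<Rightarrow> 'p heap \<Rightarrow> 'p heap \<Rightarrow> bool" where
  "agree_outside A m m' \<longleftrightarrow> ptr_up m' = ptr_up m \<and> ptr_down m' = ptr_down m \<and>
    (\<forall>p. p \<notin> A \<longrightarrow> ptr_right m' p = ptr_right m p \<and> ptr_left m' p = ptr_left m p)"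

lemma node_adj_nodes: "node_adj h S p q \<Longrightarrow> p \<in> nodes h S \<and> q \<in> nodes h S"
  using level_adj_elements[of h S "snd p" "fst p" "fst q"]
  by (cases p; cases q) (auto simp: node_adj_def nodes_def)

text \<open>\<open>P\<close> is constrained on allocated nodes only, which suffices because
  \<open>node_adj\<close> relates only such nodes and never changes the level.\<close>

lemma skip_node_adj_iff:
  assumes "\<And>e i. (e, i) \<in> nodes h S \<Longrightarrow> P (e, i) \<longleftrightarrow> Suc i \<le> h e" "1 \<le> i"
  shows "skip (node_adj h S) P (a, i) (b, j) \<longleftrightarrow>
    i = j \<and> skip (level_adj h S i) (\<lambda>e. Suc i \<le> h e) a b"
proof
  have "snd p = i \<Longrightarrow> snd q = i \<and> skip (level_adj h S i) (\<lambda>e. Suc i \<le> h e) (fst p) (fst q)"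
    if "skip (node_adj h S) P p q" for p q
    using that
  proof (induction rule: skip.induct)
    case (hit p q)
    have "P q \<longleftrightarrow> Suc (snd q) \<le> h (fst q)"
      using assms(1)[of "fst q" "snd q"] node_adj_nodes[OF hit(1)] by simp
    then show ?case using hit by (auto simp: node_adj_def intro: skip.hit)
  next
    case (pass p r q)
    have "P r \<longleftrightarrow> Suc (snd r) \<le> h (fst r)"
      using assms(1)[of "fst r" "snd r"] node_adj_nodes[OF pass(1)] by simp
    then show ?case using pass skip.pass[of "level_adj h S i" "fst p" "fst r"]
      by (auto simp: node_adj_def)
  qed
  then show "skip (node_adj h S) P (a, i) (b, j) \<Longrightarrow>
    i = j \<and> skip (level_adj h S i) (\<lambda>e. Suc i \<le> h e) a b" by fastforce
next
  assume "i = j \<and> skip (level_adj h S i) (\<lambda>e. Suc i \<le> h e) a b"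
  then have "skip (level_adj h S i) (\<lambda>e. Suc i \<le> h e) a b" and j: "j = i" by auto
  then have "skip (node_adj h S) P (a, i) (b, i)"
  proof (induction rule: skip.induct)
    case (hit a b)
    then have *: "node_adj h S (a, i) (b, i)" using assms(2) by (simp add: node_adj_def)
    then show ?case using assms(1)[of b i] hit node_adj_nodes[OF *] by (auto intro: skip.hit)
  next
    case (pass a c b)
    then have *: "node_adj h S (a, i) (c, i)" using assms(2) by (simp add: node_adj_def)
    then show ?case
      using assms(1)[of c i] pass node_adj_nodes[OF *] * by (auto intro: skip.pass)
  qed
  then show "skip (node_adj h S) P (a, i) (b, j)" using j by simp
qed

lemma finite_nodes: "well_formed S \<Longrightarrow> finite (nodes h S)"
proof -
  assume "well_formed S"
  then have "finite (elements S)" by (auto simp: well_formed_def elements_def)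
  then have "finite (SIGMA e:elements S. {..h e})" by auto
  then show ?thesis by (rule rev_finite_subset) (auto simp: nodes_def)
qed

lemma concurrent_join_skip_list:
  assumes "valid_skip_list h S m" "join_all S B S'"
  shows "concurrent_join (node_adj h S') (node_adj h S) (nodes h S) snd m (map start_join B)"
proof -
  have wf: "well_formed S" and pos: "\<forall>e\<in>elements S. 1 \<le> h e"
    and up: "\<And>e i. (e, i) \<in> nodes h S \<Longrightarrow> ptr_up m (e, i) = (if i < h e then Some (e, i + 1) else None)"
    and linked: "horizontally_linked (node_adj h S) (nodes h S) m"
    using assms(1) unfolding valid_skip_list_iff by auto
  note props = join_all_props[OF assms(2) wf]
  have nodes: "nodes h S' = nodes h S" using props(2) by (simp add: nodes_def)
  have base: "level_adj h S' 1 a b \<longleftrightarrow> level_adj h S 1 a b \<or> (a, b) \<in> set B" for a b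
    using level_adj_1[of S h] level_adj_1[of S' h] pos props(2,3) by simp
  \<comment> \<open>Stated for any \<open>T\<close> with the same nodes: vertical pointers do not
    depend on how elements are linked, so both \<open>S\<close> and \<open>S'\<close> are
    instances.\<close>
  have climb: "node_adj h T p' q' \<longleftrightarrow> skip (node_adj h T) (\<lambda>x. ptr_up m x \<noteq> None) p q"
    if "well_formed T" "nodes h T = nodes h S" "p \<in> nodes h S" "q \<in> nodes h S"
      "ptr_up m p = Some p'" "ptr_up m q = Some q'" for T p q p' q'
  proof -
    obtain a i b j where pq: "p = (a, i)" "q = (b, j)" by fastforce
    have i: "1 \<le> i" using that(3) by (simp add: pq nodes_def)
    have p': "p' = (a, Suc i)" "q' = (b, Suc j)" "Suc i \<le> h a"
      using that(3-6) up by (auto simp: pq split: if_splits)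
    show ?thesis
      unfolding pq p' using skip_node_adj_iff[of h T "\<lambda>x. ptr_up m x \<noteq> None" i a b j] up that(2) i
        level_adj_Suc[OF that(1), of h i a b] p'(3)
      by (auto simp: node_adj_def)
  qed
  show ?thesis
  proof
    show "finite (nodes h S)" using wf by (rule finite_nodes)
    show "p \<in> nodes h S \<and> q \<in> nodes h S" if "node_adj h S' p q" for p q
      using node_adj_nodes[OF that] nodes by simp
    show "snd p = snd q" if "node_adj h S' p q" for p q using that by (simp add: node_adj_def)
    show "q = q'" if "node_adj h S' p q" "node_adj h S' p q'" for p q q'
      using that level_adj_functional[OF props(1)] by (auto simp: node_adj_def intro!: prod_eqI)
    show "p = p'" if "node_adj h S' p q" "node_adj h S' p' q" for p p' q
      using that level_adj_injective[OF props(1)] by (auto simp: node_adj_def intro!: prod_eqI)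
    show "node_adj h S' p q" if "node_adj h S p q" for p q
      using that level_adj_mono[OF wf props(1)] base by (auto simp: node_adj_def)
    show "horizontally_linked (node_adj h S) (nodes h S) m" by (rule linked)
    show "p' \<in> nodes h S \<and> snd p' = Suc (snd p)"
      if "p \<in> nodes h S" "ptr_up m p = Some p'" for p p'
      using that up[of "fst p" "snd p"] by (cases p) (auto simp: nodes_def split: if_splits)
    show "\<exists>q\<in>nodes h S. ptr_up m q = Some p" if p_node: "p \<in> nodes h S" "snd p \<noteq> 1" for p
    proof -
      obtain e j where ej: "p = (e, j)" by (cases p)
      then obtain i where p: "p = (e, Suc i)" "1 \<le> i"
        using p_node by (cases j) (auto simp: nodes_def)
      then have "(e, i) \<in> nodes h S" using that by (auto simp: nodes_def)
      moreover have "ptr_up m (e, i) = Some p" using up[OF calculation] that p by (simp add: nodes_def)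
      ultimately show ?thesis by blast
    qed
    show "node_adj h S' p' q' \<longleftrightarrow> skip (node_adj h S') (\<lambda>x. ptr_up m x \<noteq> None) p q"
      if "p \<in> nodes h S" "q \<in> nodes h S" "ptr_up m p = Some p'" "ptr_up m q = Some q'" for p q p' q'
      using props(1) nodes that by (rule climb)
    show "node_adj h S p' q'"
      if "p \<in> nodes h S" "q \<in> nodes h S" "ptr_up m p = Some p'" "ptr_up m q = Some q'"
        "skip (node_adj h S) (\<lambda>x. ptr_up m x \<noteq> None) p q" for p q p' q'
      using climb[OF wf refl that(1-4)] that(5) by blast
    show "\<exists>p q. c = CasRight p q \<and> node_adj h S' p q" if "c \<in> set (map start_join B)" for c
      using that base by (auto simp: start_join_def node_adj_def)
    show "CasRight p q \<in> set (map start_join B)"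
      if "node_adj h S' p q" "snd p = 1" "\<not> node_adj h S p q" for p q
    proof -
      have "(fst p, fst q) \<in> set B" "p = (fst p, 1)" "q = (fst q, 1)"
        using that base[of "fst p" "fst q"] by (auto simp: node_adj_def intro!: prod_eqI)
      then show ?thesis by (force simp: start_join_def)
    qed
  qed
qed

lemma concurrent_run:
  assumes "valid_skip_list h S m" "join_all S B S'"
  shows "\<nexists>run. run 0 = (m, map start_join B) \<and> (\<forall>n::nat. step (run n) (run (Suc n)))"
    and "step\<^sup>*\<^sup>* (m, map start_join B) (mf, cs) \<Longrightarrow> \<nexists>d. step (mf, cs) d \<Longrightarrow>
      (\<forall>c\<in>set cs. c = Done) \<and> valid_skip_list h S' mf \<and> agree_outside (nodes h S) m mf"
proof -
  interpret concurrent_join "node_adj h S'" "node_adj h S" "nodes h S" snd m "map start_join B"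
    using assms by (rule concurrent_join_skip_list)
  show "\<nexists>run. run 0 = (m, map start_join B) \<and> (\<forall>n::nat. step (run n) (run (Suc n)))"
    by (rule no_infinite_run)
  assume *: "step\<^sup>*\<^sup>* (m, map start_join B) (mf, cs)" "\<nexists>d. step (mf, cs) d"
  have "well_formed S" using assms(1) by (simp add: valid_skip_list_def)
  note props = join_all_props[OF assms(2) this]
  have "nodes h S' = nodes h S" using props(2) by (simp add: nodes_def)
  then show "(\<forall>c\<in>set cs. c = Done) \<and> valid_skip_list h S' mf \<and> agree_outside (nodes h S) m mf"
    using terminal_state[OF *] props assms(1)
    unfolding valid_skip_list_iff agree_outside_def by simp
qed

section \<open>Terminal states exist; the sequential run\<close>

lemma stuck_state_reachable:
  assumes "\<nexists>run. run 0 = s \<and> (\<forall>n::nat. step (run n) (run (Suc n)))"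
  shows "\<exists>t. step\<^sup>*\<^sup>* s t \<and> (\<nexists>d. step t d)"
proof (rule ccontr)
  assume "\<not> ?thesis"
  then have progress: "\<exists>d. step t d" if "step\<^sup>*\<^sup>* s t" for t using that by blast
  \<comment> \<open>The clause for \<open>n = 0\<close> pins the start of the chosen run to
    \<open>s\<close>.\<close>
  have "\<exists>run. \<forall>n::nat. (step\<^sup>*\<^sup>* s (run n) \<and> (n = 0 \<longrightarrow> run n = s)) \<and> step (run n) (run (Suc n))"
  proof (rule dependent_nat_choice)
    fix t and n :: nat
    assume "step\<^sup>*\<^sup>* s t \<and> (n = 0 \<longrightarrow> t = s)"
    then obtain u where "step\<^sup>*\<^sup>* s t" "step t u" using progress by blast
    then have "step\<^sup>*\<^sup>* s u" by (rule rtranclp.rtrancl_into_rtrancl)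
    with \<open>step t u\<close> show "\<exists>u. (step\<^sup>*\<^sup>* s u \<and> (Suc n = 0 \<longrightarrow> u = s)) \<and> step t u" by blast
  qed blast
  then show False using assms by blast
qed

lemma step_length: "step\<^sup>*\<^sup>* s t \<Longrightarrow> length (snd t) = length (snd s)"
  by (induction rule: rtranclp_induct) (auto elim!: step.cases)

text \<open>Each single join is a concurrent run of one thread: termination yields a stuck state,
  and \<open>concurrent_run\<close> makes it valid for the next join.\<close>

lemma sequential_result:
  assumes "valid_skip_list h S m" "valid_join_inputs S B"
  shows "\<exists>S' m'. join_all S B S' \<and> sequential_run m B m' \<and> valid_skip_list h S' m' \<and>
    agree_outside (nodes h S) m m'"
  using assms
proof (induction B arbitrary: S m)
  case Nil
  then show ?case by (auto simp: agree_outside_def intro: join_all.Nil sequential_run.Nil)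
next
  case (Cons b B)
  have wf: "well_formed S" using Cons.prems(1) by (simp add: valid_skip_list_def)
  obtain S1 where S1: "join_sequences S b S1" "valid_join_inputs S1 B"
    using join_sequences_exists[OF wf Cons.prems(2)] .
  have "join_all S [b] S1" using S1(1) by (blast intro: join_all.intros)
  note conc = concurrent_run[OF Cons.prems(1) this]
  obtain t where t: "step\<^sup>*\<^sup>* (m, map start_join [b]) t" "\<nexists>d. step t d"
    using stuck_state_reachable[OF conc(1)] by blast
  obtain m1 cs where mcs: "t = (m1, cs)" by (cases t)
  have res: "\<forall>c\<in>set cs. c = Done" "valid_skip_list h S1 m1" "agree_outside (nodes h S) m m1"
    using conc(2) t mcs by blast+
  have "length cs = 1" using step_length[OF t(1)] mcs by simp
  then have "cs = [Done]" using res(1) by (cases cs) auto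
  then have run: "step\<^sup>*\<^sup>* (m, [start_join b]) (m1, [Done])" using t(1) mcs by simp
  obtain S' m' where IH: "join_all S1 B S'" "sequential_run m1 B m'" "valid_skip_list h S' m'"
    "agree_outside (nodes h S1) m1 m'"
    using Cons.IH[OF res(2) S1(2)] by blast
  have "nodes h S1 = nodes h S"
    using join_sequences_props(2)[OF S1(1) wf] by (simp add: nodes_def)
  then have "agree_outside (nodes h S) m m'"
    using res(3) IH(4) by (simp add: agree_outside_def)
  then show ?case
    using IH join_all.Cons[OF S1(1)] sequential_run.Cons[OF run] by blast
qed

theorem theorem1:
  fixes h :: "'e \<Rightarrow> nat" and S :: "'e sequence set" and m :: "('e \<times> nat) heap"
    and B :: "('e \<times> 'e) list"
  assumes "valid_skip_list h S m"
    and "valid_join_inputs S B"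
  shows "(\<nexists>run. run 0 = (m, map start_join B) \<and> (\<forall>n::nat. step (run n) (run (Suc n)))) \<and>
    (\<exists>S' m'. join_all S B S' \<and> valid_skip_list h S' m' \<and> sequential_run m B m' \<and>
      (\<forall>mf cs. step\<^sup>*\<^sup>* (m, map start_join B) (mf, cs) \<and> (\<nexists>d. step (mf, cs) d) \<longrightarrow>
        (\<forall>c\<in>set cs. c = Done) \<and> mf = m'))"
proof -
  obtain S' m' where seq: "join_all S B S'" "sequential_run m B m'" "valid_skip_list h S' m'"
    "agree_outside (nodes h S) m m'"
    using sequential_result[OF assms] by blast
  have wf: "well_formed S" using assms(1) by (simp add: valid_skip_list_def)
  have nodes: "nodes h S' = nodes h S"
    using join_all_props(2)[OF seq(1) wf] by (simp add: nodes_def)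
  note conc = concurrent_run[OF assms(1) seq(1)]
  have "(\<forall>c\<in>set cs. c = Done) \<and> mf = m'"
    if "step\<^sup>*\<^sup>* (m, map start_join B) (mf, cs)" "\<nexists>d. step (mf, cs) d" for mf cs
  proof -
    have res: "\<forall>c\<in>set cs. c = Done" "valid_skip_list h S' mf" "agree_outside (nodes h S) m mf"
      using conc(2)[OF that] by blast+
    \<comment> \<open>Both heaps are valid for the same \<open>S'\<close> and agree with
      \<open>m\<close> outside its nodes, which leaves no freedom.\<close>
    have "mf = m'"
      by (rule horizontally_linked_unique[of "node_adj h S'" "nodes h S'"])
        (use res(2,3) seq(3,4) nodes in \<open>simp_all add: valid_skip_list_iff agree_outside_def\<close>)
    with res(1) show ?thesis by blast
  qed
  then show ?thesis using conc(1) seq by blast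
qed

end
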